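(* Let $\mathcal{Y}$ be a non-empty set and let $\mathcal{D}\subseteq\mathcal{L}(\mathcal{Y})$ be a linear space of bounded real functions that contains all constant real functions and is closed under pointwise minima. Let $\mathcal{E}$ be a convex expectation on $\mathcal{D}$ that is downward continuous, and let $\hat{\mathcal{E}}\colon\mathcal{M}(\mathcal{D})\to\overline{\mathbb{R}}$ be defined for all $f\in\mathcal{M}(\mathcal{D})$ by $$\hat{\mathcal{E}}(f)\coloneqq\sup\Big\{\int f\,\mathrm{d}P_E-\mathcal{E}^*(E)\colon E\in\mathbb{E}_{\mathcal{D}},\ \mathcal{E}^*(E)<+\infty\Big\}.$$ Then $\hat{\mathcal{E}}$ is a convex expectation that extends $\mathcal{E}$, is downward continuous on $\mathcal{D}_{\delta,\mathrm{b}}$ and upward continuous on $\mathcal{M}_{\mathrm{b}}(\mathcal{D})$. Furthermore, if $\mathcal{E}$ is an upper expectation, then $\hat{\mathcal{E}}$ is a sublinear expectation.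
   Context: $\overline{\mathbb{R}}=\mathbb{R}\cup\{-\infty,+\infty\}$, with the standard conventions (including $0\cdot(\pm\infty)=0$); a sum or difference of extended reals is meaningful if it does not lead to $(+\infty)-(+\infty)$ or $(+\infty)+(-\infty)$. $\mathcal{L}(\mathcal{Y})$ is the set of bounded real-valued functions on $\mathcal{Y}$. Order and limits of functions are pointwise; $(f_n)_{n\in\mathbb{N}}\searrow f$ (resp. $\nearrow f$) denotes a decreasing (resp. increasing) sequence of functions with pointwise limit $f$. Let $\mathcal{G}\subseteq\overline{\mathbb{R}}^{\mathcal{Y}}$ be non-empty and $\Phi\colon\mathcal{G}\to\overline{\mathbb{R}}$ a functional. $\Phi$ is isotone if $\Phi(f)\le\Phi(g)$ for all $f\le g$ in $\mathcal{G}$; positively homogeneous if $\Phi(\mu f)=\mu\Phi(f)$ for all $f\in\mathcal{G}$ and real $\mu\ge0$ with $\mu f\in\mathcal{G}$ (homogeneous: the same for all real $\mu$); convex if $\Phi(\lambda f+(1-\lambda)g)\le\lambda\Phi(f)+(1-\lambda)\Phi(g)$ for all $f,g\in\mathcal{G}$, $\lambda\in[0,1]$ such that $\lambda f+(1-\lambda)g$ is meaningful and in $\mathcal{G}$ and the right-hand side is meaningful; subadditive if $\Phi(f+g)\le\Phi(f)+\Phi(g)$ for all $f,g\in\mathcal{G}$ such that $f+g$ is meaningful and in $\mathcal{G}$ and the right-hand side is meaningful (additive: with equality). For $\mathcal{C}\subseteq\mathcal{G}$, $\Phi$ is downward (resp. upward) continuous on $\mathcal{C}$ if $\lim_{n}\Phi(f_n)=\Phi(f)$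 whenever $f_n,f\in\mathcal{C}$ and $(f_n)\searrow f$ (resp. $(f_n)\nearrow f$); if $\mathcal{C}$ is not mentioned, $\mathcal{C}=\mathcal{G}$. A nonlinear expectation is an isotone functional $\Phi$ whose domain contains all constant real functions and with $\Phi(\mu)=\mu$ for all $\mu\in\mathbb{R}$. A convex expectation is a convex nonlinear expectation; a sublinear expectation is a subadditive and positively homogeneous nonlinear expectation; an upper expectation is a sublinear expectation whose domain is a linear space of real functions; a linear expectation is an upper expectation that is homogeneous and additive. $\mathbb{E}_{\mathcal{D}}$ is the set of all linear expectations on $\mathcal{D}$, and for $E\in\mathbb{E}_{\mathcal{D}}$, $\mathcal{E}^*(E)\coloneqq\sup\{E(f)-\mathcal{E}(f)\colon f\in\mathcal{D}\}\in\mathbb{R}\cup\{+\infty\}$. $\sigma(\mathcal{D})$ is the smallest $\sigma$-algebra on $\mathcal{Y}$ making every $f\in\mathcal{D}$ Borel measurable. It is known that since $\mathcal{E}$ is downward continuous, every $E\in\mathbb{E}_{\mathcal{D}}$ with $\mathcal{E}^*(E)<+\infty$ is downward continuous, and so by the Daniell–Stone Theorem there is a unique probability measure $P_E$ on $\sigma(\mathcal{D})$ with $E(f)=\int f\,\mathrm{d}P_E$ for all $f\in\mathcal{D}$. $\mathcal{M}_{\mathrm{b}}(\mathcal{D})$ (resp. $\mathcal{M}^{\mathrm{b}}(\mathcal{D})$) is the set of $\sigma(\mathcal{D})/\mathcal{B}(\overline{\mathbb{R}})$-measurable functions $f\colon\mathcal{Y}\to\overline{\mathbb{R}}$ that are bounded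 below, $\inf f>-\infty$ (resp. bounded above, $\sup f<+\infty$), and $\mathcal{M}(\mathcal{D})\coloneqq\mathcal{M}_{\mathrm{b}}(\mathcal{D})\cup\mathcal{M}^{\mathrm{b}}(\mathcal{D})$; Lebesgue integrals of functions in $\mathcal{M}(\mathcal{D})$ take values in $\overline{\mathbb{R}}$. Finally, $\mathcal{D}_{\delta,\mathrm{b}}\coloneqq\{f\in\mathcal{L}(\mathcal{Y})\colon\exists(f_n)_{n\in\mathbb{N}}\in\mathcal{D}^{\mathbb{N}},\ (f_n)_{n\in\mathbb{N}}\searrow f\}$. *)

theory Defs
  imports "HOL-Probability.Probability"
begin

text \<open>
  Functions on the non-empty set \<open>\<Y>\<close> (the type \<open>'y\<close>) are represented as \<open>'y \<Rightarrow> ereal\<close>, real functions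
  being those with finite values. A functional with domain \<open>G\<close> is a total function of type
  \<open>('y \<Rightarrow> ereal) \<Rightarrow> ereal\<close> together with \<open>G\<close>; its values outside \<open>G\<close> are irrelevant.
\<close>

text \<open>In \<^typ>\<open>ereal\<close> one has \<open>0 * \<infinity> = 0\<close>, but also \<open>\<infinity> + (-\<infinity>) = \<infinity>\<close>, so sums have to be guarded.\<close>

definition meaningful :: "ereal \<Rightarrow> ereal \<Rightarrow> bool" where
  "meaningful a b \<longleftrightarrow> \<not> (a = \<infinity> \<and> b = -\<infinity>) \<and> \<not> (a = -\<infinity> \<and> b = \<infinity>)"

definition meaningful_fun :: "('y \<Rightarrow> ereal) \<Rightarrow> ('y \<Rightarrow> ereal) \<Rightarrow> bool" where
  "meaningful_fun f g \<longleftrightarrow> (\<forall>y. meaningful (f y) (g y))"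


subsection \<open>Properties of functionals\<close>

definition isotone :: "('y \<Rightarrow> ereal) set \<Rightarrow> (('y \<Rightarrow> ereal) \<Rightarrow> ereal) \<Rightarrow> bool" where
  "isotone G \<Phi> \<longleftrightarrow> (\<forall>f\<in>G. \<forall>g\<in>G. f \<le> g \<longrightarrow> \<Phi> f \<le> \<Phi> g)"

definition positively_homogeneous ::
  "('y \<Rightarrow> ereal) set \<Rightarrow> (('y \<Rightarrow> ereal) \<Rightarrow> ereal) \<Rightarrow> bool" where
  "positively_homogeneous G \<Phi> \<longleftrightarrow>
     (\<forall>f\<in>G. \<forall>\<mu>::real. \<mu> \<ge> 0 \<longrightarrow> (\<lambda>y. ereal \<mu> * f y) \<in> G \<longrightarrow>
        \<Phi> (\<lambda>y. ereal \<mu> * f y) = ereal \<mu> * \<Phi> f)"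

definition homogeneous ::
  "('y \<Rightarrow> ereal) set \<Rightarrow> (('y \<Rightarrow> ereal) \<Rightarrow> ereal) \<Rightarrow> bool" where
  "homogeneous G \<Phi> \<longleftrightarrow>
     (\<forall>f\<in>G. \<forall>\<mu>::real. (\<lambda>y. ereal \<mu> * f y) \<in> G \<longrightarrow>
        \<Phi> (\<lambda>y. ereal \<mu> * f y) = ereal \<mu> * \<Phi> f)"

definition convex_functional ::
  "('y \<Rightarrow> ereal) set \<Rightarrow> (('y \<Rightarrow> ereal) \<Rightarrow> ereal) \<Rightarrow> bool" where
  "convex_functional G \<Phi> \<longleftrightarrow>
     (\<forall>f\<in>G. \<forall>g\<in>G. \<forall>l::real. 0 \<le> l \<longrightarrow> l \<le> 1 \<longrightarrow>
        meaningful_fun (\<lambda>y. ereal l * f y) (\<lambda>y. ereal (1 - l) * g y) \<longrightarrow>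
        (\<lambda>y. ereal l * f y + ereal (1 - l) * g y) \<in> G \<longrightarrow>
        meaningful (ereal l * \<Phi> f) (ereal (1 - l) * \<Phi> g) \<longrightarrow>
        \<Phi> (\<lambda>y. ereal l * f y + ereal (1 - l) * g y) \<le> ereal l * \<Phi> f + ereal (1 - l) * \<Phi> g)"

definition subadditive ::
  "('y \<Rightarrow> ereal) set \<Rightarrow> (('y \<Rightarrow> ereal) \<Rightarrow> ereal) \<Rightarrow> bool" where
  "subadditive G \<Phi> \<longleftrightarrow>
     (\<forall>f\<in>G. \<forall>g\<in>G. meaningful_fun f g \<longrightarrow> (\<lambda>y. f y + g y) \<in> G \<longrightarrow>
        meaningful (\<Phi> f) (\<Phi> g) \<longrightarrow> \<Phi> (\<lambda>y. f y + g y) \<le> \<Phi> f + \<Phi> g)"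

definition additive_functional ::
  "('y \<Rightarrow> ereal) set \<Rightarrow> (('y \<Rightarrow> ereal) \<Rightarrow> ereal) \<Rightarrow> bool" where
  "additive_functional G \<Phi> \<longleftrightarrow>
     (\<forall>f\<in>G. \<forall>g\<in>G. meaningful_fun f g \<longrightarrow> (\<lambda>y. f y + g y) \<in> G \<longrightarrow>
        meaningful (\<Phi> f) (\<Phi> g) \<longrightarrow> \<Phi> (\<lambda>y. f y + g y) = \<Phi> f + \<Phi> g)"

definition decreases_to :: "(nat \<Rightarrow> 'y \<Rightarrow> ereal) \<Rightarrow> ('y \<Rightarrow> ereal) \<Rightarrow> bool" where
  "decreases_to F f \<longleftrightarrow> decseq F \<and> (\<forall>y. (\<lambda>n. F n y) \<longlonglongrightarrow> f y)"

definition increases_to :: "(nat \<Rightarrow> 'y \<Rightarrow> ereal) \<Rightarrow> ('y \<Rightarrow> ereal) \<Rightarrow> bool" where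
  "increases_to F f \<longleftrightarrow> incseq F \<and> (\<forall>y. (\<lambda>n. F n y) \<longlonglongrightarrow> f y)"

definition downward_continuous_on ::
  "('y \<Rightarrow> ereal) set \<Rightarrow> ('y \<Rightarrow> ereal) set \<Rightarrow> (('y \<Rightarrow> ereal) \<Rightarrow> ereal) \<Rightarrow> bool" where
  "downward_continuous_on C G \<Phi> \<longleftrightarrow> C \<subseteq> G \<and>
     (\<forall>F f. (\<forall>n. F n \<in> C) \<longrightarrow> f \<in> C \<longrightarrow> decreases_to F f \<longrightarrow> (\<lambda>n. \<Phi> (F n)) \<longlonglongrightarrow> \<Phi> f)"

definition upward_continuous_on ::
  "('y \<Rightarrow> ereal) set \<Rightarrow> ('y \<Rightarrow> ereal) set \<Rightarrow> (('y \<Rightarrow> ereal) \<Rightarrow> ereal) \<Rightarrow> bool" where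
  "upward_continuous_on C G \<Phi> \<longleftrightarrow> C \<subseteq> G \<and>
     (\<forall>F f. (\<forall>n. F n \<in> C) \<longrightarrow> f \<in> C \<longrightarrow> increases_to F f \<longrightarrow> (\<lambda>n. \<Phi> (F n)) \<longlonglongrightarrow> \<Phi> f)"

abbreviation downward_continuous ::
  "('y \<Rightarrow> ereal) set \<Rightarrow> (('y \<Rightarrow> ereal) \<Rightarrow> ereal) \<Rightarrow> bool" where
  "downward_continuous G \<Phi> \<equiv> downward_continuous_on G G \<Phi>"

definition extends_functional ::
  "('y \<Rightarrow> ereal) set \<Rightarrow> (('y \<Rightarrow> ereal) \<Rightarrow> ereal) \<Rightarrow>
   ('y \<Rightarrow> ereal) set \<Rightarrow> (('y \<Rightarrow> ereal) \<Rightarrow> ereal) \<Rightarrow> bool" where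
  "extends_functional H \<Psi> G \<Phi> \<longleftrightarrow> G \<subseteq> H \<and> (\<forall>f\<in>G. \<Psi> f = \<Phi> f)"


subsection \<open>Nonlinear expectations\<close>

definition linear_space_of_real_functions :: "('y \<Rightarrow> ereal) set \<Rightarrow> bool" where
  "linear_space_of_real_functions G \<longleftrightarrow>
     (\<forall>f\<in>G. \<forall>y. \<bar>f y\<bar> \<noteq> \<infinity>) \<and>
     (\<lambda>y. 0) \<in> G \<and>
     (\<forall>f\<in>G. \<forall>g\<in>G. (\<lambda>y. f y + g y) \<in> G) \<and>
     (\<forall>f\<in>G. \<forall>\<mu>::real. (\<lambda>y. ereal \<mu> * f y) \<in> G)"

definition nonlinear_expectation ::
  "('y \<Rightarrow> ereal) set \<Rightarrow> (('y \<Rightarrow> ereal) \<Rightarrow> ereal) \<Rightarrow> bool" where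
  "nonlinear_expectation G \<Phi> \<longleftrightarrow>
     isotone G \<Phi> \<and> (\<forall>\<mu>::real. (\<lambda>y. ereal \<mu>) \<in> G \<and> \<Phi> (\<lambda>y. ereal \<mu>) = ereal \<mu>)"

definition convex_expectation ::
  "('y \<Rightarrow> ereal) set \<Rightarrow> (('y \<Rightarrow> ereal) \<Rightarrow> ereal) \<Rightarrow> bool" where
  "convex_expectation G \<Phi> \<longleftrightarrow> nonlinear_expectation G \<Phi> \<and> convex_functional G \<Phi>"

definition sublinear_expectation ::
  "('y \<Rightarrow> ereal) set \<Rightarrow> (('y \<Rightarrow> ereal) \<Rightarrow> ereal) \<Rightarrow> bool" where
  "sublinear_expectation G \<Phi> \<longleftrightarrow>
     nonlinear_expectation G \<Phi> \<and> subadditive G \<Phi> \<and> positively_homogeneous G \<Phi>"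

definition upper_expectation ::
  "('y \<Rightarrow> ereal) set \<Rightarrow> (('y \<Rightarrow> ereal) \<Rightarrow> ereal) \<Rightarrow> bool" where
  "upper_expectation G \<Phi> \<longleftrightarrow> sublinear_expectation G \<Phi> \<and> linear_space_of_real_functions G"

definition linear_expectation ::
  "('y \<Rightarrow> ereal) set \<Rightarrow> (('y \<Rightarrow> ereal) \<Rightarrow> ereal) \<Rightarrow> bool" where
  "linear_expectation G \<Phi> \<longleftrightarrow>
     upper_expectation G \<Phi> \<and> homogeneous G \<Phi> \<and> additive_functional G \<Phi>"

definition linear_expectations ::
  "('y \<Rightarrow> ereal) set \<Rightarrow> (('y \<Rightarrow> ereal) \<Rightarrow> ereal) set" where
  "linear_expectations D = {E. linear_expectation D E}"

definition conjugate ::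
  "('y \<Rightarrow> ereal) set \<Rightarrow> (('y \<Rightarrow> ereal) \<Rightarrow> ereal) \<Rightarrow> (('y \<Rightarrow> ereal) \<Rightarrow> ereal) \<Rightarrow> ereal" where
  "conjugate D \<E> E = (SUP f\<in>D. E f - \<E> f)"


subsection \<open>Function classes\<close>

definition bounded_real_functions :: "('y \<Rightarrow> ereal) set" where
  "bounded_real_functions = {f. \<exists>c::real. \<forall>y. \<bar>f y\<bar> \<le> ereal c}"

definition sigma_of :: "('y \<Rightarrow> ereal) set \<Rightarrow> 'y measure" where
  "sigma_of D = sigma UNIV {f -` B | f B. f \<in> D \<and> B \<in> sets borel}"

definition M_below :: "('y \<Rightarrow> ereal) set \<Rightarrow> ('y \<Rightarrow> ereal) set" where
  "M_below D = {f \<in> borel_measurable (sigma_of D). (INF y. f y) > -\<infinity>}"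

definition M_above :: "('y \<Rightarrow> ereal) set \<Rightarrow> ('y \<Rightarrow> ereal) set" where
  "M_above D = {f \<in> borel_measurable (sigma_of D). (SUP y. f y) < \<infinity>}"

definition M_all :: "('y \<Rightarrow> ereal) set \<Rightarrow> ('y \<Rightarrow> ereal) set" where
  "M_all D = M_below D \<union> M_above D"

definition D_delta_b :: "('y \<Rightarrow> ereal) set \<Rightarrow> ('y \<Rightarrow> ereal) set" where
  "D_delta_b D = {f \<in> bounded_real_functions. \<exists>F. (\<forall>n. F n \<in> D) \<and> decreases_to F f}"


subsection \<open>Integral representation and extension\<close>

text \<open>
  Since \<^const>\<open>e2ennreal\<close> sends negative numbers to \<open>0\<close>, this is the integral of the positive part
  minus that of the negative part; for a probability measure at least one of the two is finite
  whenever \<open>f\<close> is bounded below or bounded above.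
\<close>

definition ereal_integral :: "'y measure \<Rightarrow> ('y \<Rightarrow> ereal) \<Rightarrow> ereal" where
  "ereal_integral P f =
     enn2ereal (\<integral>\<^sup>+ y. e2ennreal (f y) \<partial>P) - enn2ereal (\<integral>\<^sup>+ y. e2ennreal (- f y) \<partial>P)"

definition represents ::
  "('y \<Rightarrow> ereal) set \<Rightarrow> (('y \<Rightarrow> ereal) \<Rightarrow> ereal) \<Rightarrow> 'y measure \<Rightarrow> bool" where
  "represents D E P \<longleftrightarrow>
     prob_space P \<and> sets P = sets (sigma_of D) \<and> (\<forall>f\<in>D. E f = ereal_integral P f)"

text \<open>Existence and uniqueness hold by the Daniell--Stone theorem for downward continuous \<open>E\<close>.\<close>

definition repr_measure ::
  "('y \<Rightarrow> ereal) set \<Rightarrow> (('y \<Rightarrow> ereal) \<Rightarrow> ereal) \<Rightarrow> 'y measure" where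
  "repr_measure D E = (THE P. represents D E P)"

definition extension ::
  "('y \<Rightarrow> ereal) set \<Rightarrow> (('y \<Rightarrow> ereal) \<Rightarrow> ereal) \<Rightarrow> ('y \<Rightarrow> ereal) \<Rightarrow> ereal" where
  "extension D \<E> f =
     (SUP E\<in>{E \<in> linear_expectations D. conjugate D \<E> E < \<infinity>}.
        ereal_integral (repr_measure D E) f - conjugate D \<E> E)"

end

theory Submission
  imports Defs "HOL-Library.Function_Algebras"
begin

text \<open>
  Two classical results carry the proof. Hahn--Banach, for a convex functional on a vector space: a
  minimal sublinear minorant is linear. Daniell--Stone: for a linear expectation \<open>I\<close> that is downward
  continuous at \<open>0\<close>, the set function \<open>A \<mapsto> inf (sup\<^sub>n I (F n))\<close> over increasing sequences \<open>F\<close> of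
  nonnegative elements of the lattice that eventually reach \<open>1\<close> on \<open>A\<close> is an outer measure for which
  the sets \<open>{f > 0}\<close> are Caratheodory measurable.

  No weak compactness is needed for downward continuity. If \<open>U n\<close> decreases in \<open>\<D>\<close> and is bounded
  below, a linear minorant \<open>L\<close> of the convex functional \<open>h \<mapsto> lim \<E> (h + U n) - lim \<E> (U n)\<close>
  satisfies \<open>L (U n) - \<E>\<^sup>* L \<ge> lim \<E> (U n)\<close> for all \<open>n\<close> at once, and monotone convergence passes this
  to the limit function. The constant sequence gives the dual representation of \<open>\<E>\<close> on \<open>\<D>\<close>, and a
  diagonal sequence reduces the general case to sequences in \<open>\<D>\<close>. Upward continuity is an interchange
  of suprema, and if \<open>\<E>\<close> is sublinear then its conjugate takes only the values \<open>0\<close> and \<open>\<infinity>\<close>.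
\<close>

section \<open>The Hahn--Banach theorem for convex functionals\<close>

definition linear_functional_on :: "'a::real_vector set \<Rightarrow> ('a \<Rightarrow> real) \<Rightarrow> bool" where
  "linear_functional_on V L \<longleftrightarrow>
     (\<forall>x\<in>V. \<forall>y\<in>V. L (x + y) = L x + L y) \<and> (\<forall>x\<in>V. \<forall>c. L (c *\<^sub>R x) = c * L x)"

text \<open>Homogeneity is asked for only as an inequality with positive factors, the form that is
  easiest to check for infima; applying it to \<open>t\<close> and to \<open>1/t\<close> recovers
  equality.\<close>

definition sublinear_functional_on :: "'a::real_vector set \<Rightarrow> ('a \<Rightarrow> real) \<Rightarrow> bool" where
  "sublinear_functional_on V q \<longleftrightarrow>
     (\<forall>x\<in>V. \<forall>y\<in>V. q (x + y) \<le> q x + q y) \<and> (\<forall>x\<in>V. \<forall>t>0. q (t *\<^sub>R x) \<le> t * q x)"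

lemma sublinear_functional_on_scale:
  assumes V: "subspace V" and q: "sublinear_functional_on V q" and x: "x \<in> V" and t: "0 \<le> t"
  shows "q (t *\<^sub>R x) = t * q x"
proof (cases "t = 0")
  case True
  \<comment> \<open>The factor 2 gives \<open>q 0 \<ge> 0\<close> and the factor 1/2 gives
    \<open>q 0 \<le> 0\<close>.\<close>
  have "q (2 *\<^sub>R 0) \<le> 2 * q 0" "q ((1/2) *\<^sub>R 0) \<le> (1/2) * q 0"
    using q subspace_0[OF V] unfolding sublinear_functional_on_def
    by (metis zero_less_numeral, metis half_gt_zero_iff zero_less_one)
  with True show ?thesis by simp
next
  case False
  with t have t: "t > 0" by simp
  have "q ((1/t) *\<^sub>R (t *\<^sub>R x)) \<le> (1/t) * q (t *\<^sub>R x)"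
    using q t subspace_scale[OF V x] unfolding sublinear_functional_on_def
    by (metis zero_less_divide_1_iff)
  then have "t * q x \<le> q (t *\<^sub>R x)"
    using t by (simp add: field_simps)
  moreover have "q (t *\<^sub>R x) \<le> t * q x"
    using q t x unfolding sublinear_functional_on_def by simp
  ultimately show ?thesis by simp
qed

lemma sublinear_functional_on_ge_uminus:
  assumes V: "subspace V" and q: "sublinear_functional_on V q" and x: "x \<in> V"
  shows "- q (- x) \<le> q x"
proof -
  have "q (0 *\<^sub>R x) = 0 * q x"
    by (rule sublinear_functional_on_scale[OF V q x]) simp
  moreover have "q (x + - x) \<le> q x + q (- x)"
    using q x subspace_neg[OF V x] unfolding sublinear_functional_on_def by blast
  ultimately show ?thesis by simp
qed

text \<open>Zorn's lemma for the reversed pointwise order. The infimum of a chain is a bound for it,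
  and it is finite because every sublinear \<open>q\<close> below \<open>p\<close> satisfies
  \<open>q x \<ge> - q (- x) \<ge> - p (- x)\<close>.\<close>

lemma exists_minimal_sublinear:
  fixes p :: "'a::real_vector \<Rightarrow> real"
  assumes V: "subspace V" and p: "sublinear_functional_on V p"
  obtains m where "sublinear_functional_on V m" "\<forall>x\<in>V. m x \<le> p x"
    "\<And>r. sublinear_functional_on V r \<Longrightarrow> \<forall>x\<in>V. r x \<le> m x \<Longrightarrow> \<forall>x\<in>V. r x = m x"
proof -
  \<comment> \<open>Values outside \<open>V\<close> are fixed to 0; left free, they could be lowered
    without end in the pointwise order.\<close>
  define A where "A = {q. sublinear_functional_on V q \<and> (\<forall>x\<in>V. q x \<le> p x) \<and> (\<forall>x. x \<notin> V \<longrightarrow> q x = 0)}"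
  define P where "P = (\<lambda>q q' :: 'a \<Rightarrow> real. q' \<le> q)"
  define p0 where "p0 = (\<lambda>x. if x \<in> V then p x else 0)"
  have trim: "sublinear_functional_on V (\<lambda>x. if x \<in> V then r x else 0)"
    if "sublinear_functional_on V r" for r
    using that subspace_add[OF V] subspace_scale[OF V] unfolding sublinear_functional_on_def by simp
  have p0: "p0 \<in> A"
    using trim[OF p] unfolding A_def p0_def by simp
  have "\<exists>m\<in>A. \<forall>a\<in>A. P m a \<longrightarrow> a = m"
  proof (rule predicate_Zorn)
    show "partial_order_on A (relation_of P A)"
      by (rule partial_order_on_relation_ofI) (auto simp: P_def)
    fix C assume C: "C \<in> Chains (relation_of P A)"
    show "\<exists>u\<in>A. \<forall>a\<in>C. P a u"
    proof (cases "C = {}")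
      case True
      with p0 show ?thesis by blast
    next
      case ne: False
      have CA: "q \<in> A" if "q \<in> C" for q
        using C that unfolding Chains_def relation_of_def by auto
      have tot: "q \<le> q' \<or> q' \<le> q" if "q \<in> C" "q' \<in> C" for q q'
        using C that unfolding Chains_def relation_of_def P_def by auto
      define u where "u = (\<lambda>x. if x \<in> V then (INF q\<in>C. q x) else 0)"
      have bdd: "bdd_below ((\<lambda>q. q x) ` C)" if x: "x \<in> V" for x
      proof (rule bdd_belowI2)
        fix q assume "q \<in> C"
        then have q: "sublinear_functional_on V q" and "q (- x) \<le> p (- x)"
          using CA subspace_neg[OF V x] unfolding A_def by auto
        then show "- p (- x) \<le> q x"
          using sublinear_functional_on_ge_uminus[OF V q x] by linarith
      qed
      have low: "u x \<le> q x" if "q \<in> C" "x \<in> V" for q x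
        using cINF_lower[OF bdd] that unfolding u_def by auto
      have great: "a \<le> u x" if "x \<in> V" "\<And>q. q \<in> C \<Longrightarrow> a \<le> q x" for a x
        using cINF_greatest[OF ne, of a "\<lambda>q. q x"] that unfolding u_def by auto
      have "u (x + y) \<le> u x + u y" if x: "x \<in> V" and y: "y \<in> V" for x y
      proof -
        have xy: "x + y \<in> V" by (rule subspace_add[OF V x y])
        \<comment> \<open>Two members of a chain have a common lower bound \<open>r\<close> in the
          chain, and subadditivity of this single \<open>r\<close> bounds the mixed sum.\<close>
        have *: "u (x + y) \<le> q x + q' y" if qq': "q \<in> C" "q' \<in> C" for q q'
        proof -
          obtain r where r: "r \<in> C" "r \<le> q" "r \<le> q'"
            using tot[OF qq'] qq' by (metis order_refl)
          have "u (x + y) \<le> r (x + y)" by (rule low[OF r(1) xy])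
          also have "\<dots> \<le> r x + r y"
            using CA[OF r(1)] x y unfolding A_def sublinear_functional_on_def by blast
          also have "\<dots> \<le> q x + q' y"
            using r by (simp add: le_fun_def add_mono)
          finally show ?thesis .
        qed
        have "u (x + y) - q x \<le> u y" if "q \<in> C" for q
          using *[OF that] by (intro great y) (simp add: algebra_simps)
        then have "u (x + y) - u y \<le> u x"
          by (intro great x) (simp add: algebra_simps)
        then show ?thesis by simp
      qed
      moreover have "u (t *\<^sub>R x) \<le> t * u x" if x: "x \<in> V" and t: "t > 0" for x t
      proof -
        have "u (t *\<^sub>R x) / t \<le> u x"
        proof (intro great x)
          fix q assume q: "q \<in> C"
          have "u (t *\<^sub>R x) \<le> q (t *\<^sub>R x)" by (rule low[OF q subspace_scale[OF V x]])
          also have "\<dots> \<le> t * q x"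
            using CA[OF q] x t unfolding A_def sublinear_functional_on_def by blast
          finally show "u (t *\<^sub>R x) / t \<le> q x" using t by (simp add: field_simps)
        qed
        then show ?thesis using t by (simp add: field_simps)
      qed
      moreover have "u x \<le> p x" if "x \<in> V" for x
      proof -
        obtain q where q: "q \<in> C" using ne by blast
        show ?thesis using low[OF q that] CA[OF q] that unfolding A_def by force
      qed
      ultimately have "u \<in> A"
        unfolding A_def sublinear_functional_on_def by (auto simp: u_def)
      moreover have "P q u" if "q \<in> C" for q
        unfolding P_def le_fun_def
        using low[OF that] CA[OF that] by (auto simp: A_def u_def)
      ultimately show ?thesis by blast
    qed
  qed
  then obtain m where m: "m \<in> A" and min: "\<And>a. a \<in> A \<Longrightarrow> a \<le> m \<Longrightarrow> a = m"
    unfolding P_def by blast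
  show thesis
  proof
    show "sublinear_functional_on V m" "\<forall>x\<in>V. m x \<le> p x"
      using m unfolding A_def by auto
    fix r assume r: "sublinear_functional_on V r" and le: "\<forall>x\<in>V. r x \<le> m x"
    let ?r = "\<lambda>x. if x \<in> V then r x else 0"
    have "?r \<in> A"
      using trim[OF r] le m unfolding A_def by force
    moreover have "?r \<le> m"
      using le m unfolding A_def le_fun_def by simp
    ultimately have "?r = m" by (rule min)
    then show "\<forall>x\<in>V. r x = m x" by auto
  qed
qed

text \<open>For fixed \<open>x\<close>, the functional
  \<open>r y = inf (m (y + t x) - t m x)\<close> over \<open>t \<ge> 0\<close> is sublinear and
  below \<open>m\<close>, so minimality gives \<open>r = m\<close>. The choice \<open>t = 1\<close>
  then shows that \<open>m\<close> is superadditive, hence additive and odd.\<close>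

lemma minimal_sublinear_is_linear:
  fixes m :: "'a::real_vector \<Rightarrow> real"
  assumes V: "subspace V" and m: "sublinear_functional_on V m"
    and min: "\<And>r. sublinear_functional_on V r \<Longrightarrow> \<forall>x\<in>V. r x \<le> m x \<Longrightarrow> \<forall>x\<in>V. r x = m x"
  shows "linear_functional_on V m"
proof -
  have sub: "m (x + y) \<le> m x + m y" if "x \<in> V" "y \<in> V" for x y
    using m that unfolding sublinear_functional_on_def by blast
  note scale = sublinear_functional_on_scale[OF V m]
  have super: "m x + m y \<le> m (y + x)" if x: "x \<in> V" and y: "y \<in> V" for x y
  proof -
    define r where "r = (\<lambda>y. INF t\<in>{0..}. m (y + t *\<^sub>R x) - t * m x)"
    have inV: "y + t *\<^sub>R x \<in> V" if "y \<in> V" for y t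
      by (intro subspace_add[OF V] subspace_scale[OF V] that x)
    have bdd: "bdd_below ((\<lambda>t. m (y + t *\<^sub>R x) - t * m x) ` {0..})" if y: "y \<in> V" for y
    proof (rule bdd_belowI2)
      fix t :: real assume t: "t \<in> {0..}"
      \<comment> \<open>The left side is \<open>t * m x\<close>, so the bound
        \<open>- m (- y)\<close> does not depend on \<open>t\<close>.\<close>
      have "m (- y + (y + t *\<^sub>R x)) \<le> m (- y) + m (y + t *\<^sub>R x)"
        by (rule sub[OF subspace_neg[OF V y] inV[OF y]])
      then show "- m (- y) \<le> m (y + t *\<^sub>R x) - t * m x"
        using scale[OF x, of t] t by simp
    qed
    have low: "r y \<le> m (y + t *\<^sub>R x) - t * m x" if "y \<in> V" "0 \<le> t" for y t
      unfolding r_def by (rule cINF_lower[OF bdd[OF that(1)]]) (use that in simp)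
    have great: "a \<le> r y" if "\<And>t. 0 \<le> t \<Longrightarrow> a \<le> m (y + t *\<^sub>R x) - t * m x" for a y
      unfolding r_def by (rule cINF_greatest) (use that in auto)
    have "r (y + z) \<le> r y + r z" if y: "y \<in> V" and z: "z \<in> V" for y z
    proof -
      \<comment> \<open>Parameters \<open>s\<close> for \<open>y\<close> and \<open>t\<close> for
        \<open>z\<close> are merged into the parameter \<open>s + t\<close> for
        \<open>y + z\<close>.\<close>
      have *: "r (y + z) \<le> (m (y + s *\<^sub>R x) - s * m x) + (m (z + t *\<^sub>R x) - t * m x)"
        if st: "0 \<le> s" "0 \<le> t" for s t
      proof -
        have "r (y + z) \<le> m ((y + z) + (s + t) *\<^sub>R x) - (s + t) * m x"
          by (rule low) (use st subspace_add[OF V y z] in auto)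
        also have "(y + z) + (s + t) *\<^sub>R x = (y + s *\<^sub>R x) + (z + t *\<^sub>R x)"
          by (simp add: algebra_simps)
        also have "m \<dots> \<le> m (y + s *\<^sub>R x) + m (z + t *\<^sub>R x)"
          by (rule sub[OF inV[OF y] inV[OF z]])
        finally show ?thesis by (simp add: algebra_simps)
      qed
      have "r (y + z) - (m (y + s *\<^sub>R x) - s * m x) \<le> r z" if "0 \<le> s" for s
      proof (rule great)
        fix t :: real assume "0 \<le> t"
        from *[OF that this]
        show "r (y + z) - (m (y + s *\<^sub>R x) - s * m x) \<le> m (z + t *\<^sub>R x) - t * m x" by linarith
      qed
      then have "r (y + z) - r z \<le> r y"
        by (intro great) (simp add: algebra_simps)
      then show ?thesis by simp
    qed
    moreover have "r (c *\<^sub>R y) \<le> c * r y" if y: "y \<in> V" and c: "c > 0" for y c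
    proof -
      have "r (c *\<^sub>R y) / c \<le> r y"
      proof (rule great)
        fix t :: real assume t: "0 \<le> t"
        have "r (c *\<^sub>R y) \<le> m (c *\<^sub>R y + (c * t) *\<^sub>R x) - (c * t) * m x"
          by (rule low) (use y c t subspace_scale[OF V] in auto)
        also have "c *\<^sub>R y + (c * t) *\<^sub>R x = c *\<^sub>R (y + t *\<^sub>R x)"
          by (simp add: algebra_simps)
        also have "m \<dots> = c * m (y + t *\<^sub>R x)"
          by (rule scale[OF inV[OF y]]) (use c in simp)
        finally show "r (c *\<^sub>R y) / c \<le> m (y + t *\<^sub>R x) - t * m x"
          using c by (simp add: field_simps)
      qed
      then show ?thesis using c by (simp add: field_simps)
    qed
    ultimately have "sublinear_functional_on V r"
      unfolding sublinear_functional_on_def by blast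
    moreover have "\<forall>y\<in>V. r y \<le> m y"
      using low[of _ 0] by simp
    ultimately have "r y = m y"
      using min y by blast
    then show ?thesis
      using low[OF y, of 1] by simp
  qed
  have add: "m (x + y) = m x + m y" if "x \<in> V" "y \<in> V" for x y
    using sub[OF that] super[OF that] by (simp add: add.commute)
  have zero: "m 0 = 0"
    using scale[OF subspace_0[OF V], of 0] by simp
  have neg: "m (- x) = - m x" if "x \<in> V" for x
    using add[OF that subspace_neg[OF V that]] zero by simp
  have "m (c *\<^sub>R x) = c * m x" if x: "x \<in> V" for x c
  proof (cases "c \<ge> 0")
    case False
    then have "m ((- c) *\<^sub>R (- x)) = (- c) * m (- x)"
      by (intro scale subspace_neg[OF V x]) simp
    then show ?thesis using neg[OF x] by simp
  qed (rule scale[OF x])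
  with add show ?thesis
    unfolding linear_functional_on_def by blast
qed

text \<open>The infimum \<open>q x\<close> of the quotients \<open>p (t x) / t\<close> over
  \<open>t > 0\<close>, the directional derivative of \<open>p\<close> at 0, is sublinear and below
  \<open>p\<close>. A minimal sublinear functional below \<open>q\<close> is linear.\<close>

theorem hahn_banach_convex:
  fixes p :: "'a::real_vector \<Rightarrow> real"
  assumes V: "subspace V" and p: "convex_on V p" and p0: "p 0 = 0"
  obtains L where "linear_functional_on V L" "\<And>x. x \<in> V \<Longrightarrow> L x \<le> p x"
proof -
  define q where "q = (\<lambda>x. INF t\<in>{0<..}. p (t *\<^sub>R x) / t)"
  have conv: "p (u *\<^sub>R x + v *\<^sub>R y) \<le> u * p x + v * p y"
    if "x \<in> V" "y \<in> V" "u \<ge> 0" "v \<ge> 0" "u + v = 1" for x y u v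
    using p that unfolding convex_on_def by blast
  have bdd: "bdd_below ((\<lambda>t. p (t *\<^sub>R x) / t) ` {0<..})" if x: "x \<in> V" for x
  proof (rule bdd_belowI2)
    fix t :: real assume "t \<in> {0<..}"
    then have t: "t > 0" by simp
    \<comment> \<open>The argument is a convex combination of \<open>t x\<close> and
      \<open>- x\<close> that equals 0, where \<open>p\<close> vanishes.\<close>
    have "p ((1 / (1 + t)) *\<^sub>R (t *\<^sub>R x) + (t / (1 + t)) *\<^sub>R (- x))
        \<le> (1 / (1 + t)) * p (t *\<^sub>R x) + (t / (1 + t)) * p (- x)"
      by (rule conv) (use t x in \<open>auto simp: subspace_scale[OF V] subspace_neg[OF V] field_simps\<close>)
    then have "0 \<le> (1 / (1 + t)) * (p (t *\<^sub>R x) + t * p (- x))"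
      using p0 by (simp add: algebra_simps add_divide_distrib)
    then have "0 \<le> p (t *\<^sub>R x) + t * p (- x)"
      using t by (simp add: zero_le_mult_iff zero_le_divide_iff)
    then show "- p (- x) \<le> p (t *\<^sub>R x) / t"
      using t by (simp add: field_simps)
  qed
  have low: "q x \<le> p (t *\<^sub>R x) / t" if "x \<in> V" "0 < t" for x t
    unfolding q_def by (rule cINF_lower[OF bdd[OF that(1)]]) (use that in simp)
  have great: "a \<le> q x" if "\<And>t. 0 < t \<Longrightarrow> a \<le> p (t *\<^sub>R x) / t" for a x
    unfolding q_def by (rule cINF_greatest) (use that in auto)
  have "q (x + y) \<le> q x + q y" if x: "x \<in> V" and y: "y \<in> V" for x y
  proof -
    have *: "q (x + y) \<le> p (s *\<^sub>R x) / s + p (t *\<^sub>R y) / t" if st: "0 < s" "0 < t" for s t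
    proof -
      \<comment> \<open>With this \<open>r\<close>, the point \<open>r (x + y)\<close> is the convex
        combination of \<open>s x\<close> and \<open>t y\<close> with weights
        \<open>t / (s + t)\<close> and \<open>s / (s + t)\<close>.\<close>
      define r where "r = s * t / (s + t)"
      have r: "r > 0" "t / (s + t) * s = r" "s / (s + t) * t = r"
        using st unfolding r_def by auto
      have "q (x + y) \<le> p (r *\<^sub>R (x + y)) / r"
        by (rule low[OF subspace_add[OF V x y] r(1)])
      also have "r *\<^sub>R (x + y) = (t / (s + t)) *\<^sub>R (s *\<^sub>R x) + (s / (s + t)) *\<^sub>R (t *\<^sub>R y)"
        unfolding scaleR_scaleR r by (simp add: algebra_simps)
      also have "p \<dots> \<le> t / (s + t) * p (s *\<^sub>R x) + s / (s + t) * p (t *\<^sub>R y)"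
        by (rule conv) (use st x y in \<open>auto simp: subspace_scale[OF V] simp flip: add_divide_distrib\<close>)
      also have "(t / (s + t) * p (s *\<^sub>R x) + s / (s + t) * p (t *\<^sub>R y)) / r = p (s *\<^sub>R x) / s + p (t *\<^sub>R y) / t"
        using st unfolding r_def by (simp add: divide_simps)
      finally show ?thesis using r(1) by (simp add: divide_right_mono)
    qed
    have "q (x + y) - p (s *\<^sub>R x) / s \<le> q y" if "0 < s" for s
      by (rule great) (use *[OF that] in \<open>simp add: algebra_simps\<close>)
    then have "q (x + y) - q y \<le> q x"
      by (intro great) (simp add: algebra_simps)
    then show ?thesis by simp
  qed
  moreover have "q (c *\<^sub>R x) \<le> c * q x" if x: "x \<in> V" and c: "c > 0" for x c
  proof -
    have "q (c *\<^sub>R x) / c \<le> q x"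
    proof (rule great)
      fix t :: real assume t: "0 < t"
      show "q (c *\<^sub>R x) / c \<le> p (t *\<^sub>R x) / t"
        using low[OF subspace_scale[OF V x], of "t / c" c] c t by (simp add: field_simps)
    qed
    then show ?thesis using c by (simp add: field_simps)
  qed
  ultimately have "sublinear_functional_on V q"
    unfolding sublinear_functional_on_def by blast
  then obtain m where m: "sublinear_functional_on V m" "\<forall>x\<in>V. m x \<le> q x"
    "\<And>r. sublinear_functional_on V r \<Longrightarrow> \<forall>x\<in>V. r x \<le> m x \<Longrightarrow> \<forall>x\<in>V. r x = m x"
    using exists_minimal_sublinear[OF V] by blast
  show thesis
  proof
    show "linear_functional_on V m" by (rule minimal_sublinear_is_linear[OF V m(1,3)])
    show "m x \<le> p x" if "x \<in> V" for x
      using m(2) low[OF that, of 1] that by force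
  qed
qed

text \<open>Pointwise scaling joins pointwise addition, so that \<open>subspace\<close> and the
  Hahn--Banach theorem apply to sets of functions.\<close>

instantiation "fun" :: (type, real_vector) real_vector
begin

definition scaleR_fun :: "real \<Rightarrow> ('a \<Rightarrow> 'b) \<Rightarrow> 'a \<Rightarrow> 'b" where
  "scaleR_fun c f = (\<lambda>x. c *\<^sub>R f x)"

instance
  by standard (simp_all add: scaleR_fun_def fun_eq_iff algebra_simps)

end

lemma scaleR_fun_apply [simp]: "(c *\<^sub>R f) x = c *\<^sub>R f x"
  by (simp add: scaleR_fun_def)

section \<open>The Daniell--Stone theorem\<close>

text \<open>Counts the levels \<open>k / n\<close> below the value of a function at a point in the
  layer cake argument; at most the ceiling of \<open>y\<close> many integers are eligible.\<close>

lemma card_real_less: "0 \<le> y \<Longrightarrow> real (card {k\<in>{..<n::nat}. real k < y}) \<le> y + 1"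
proof -
  assume y: "0 \<le> y"
  have "{k\<in>{..<n}. real k < y} \<subseteq> {..<nat \<lceil>y\<rceil>}"
    by auto linarith
  then have "card {k\<in>{..<n}. real k < y} \<le> card {..<nat \<lceil>y\<rceil>}"
    by (rule card_mono[rotated]) simp
  also have "\<dots> = nat \<lceil>y\<rceil>" by simp
  finally show ?thesis using y by linarith
qed

locale daniell_integral =
  fixes V :: "('a \<Rightarrow> real) set" and I :: "('a \<Rightarrow> real) \<Rightarrow> real"
  assumes subspace_V: "subspace V"
    and one_in_V: "(\<lambda>x. 1) \<in> V"
    and min_in_V: "f \<in> V \<Longrightarrow> g \<in> V \<Longrightarrow> (\<lambda>x. min (f x) (g x)) \<in> V"
    and bounded_V: "f \<in> V \<Longrightarrow> \<exists>c. \<forall>x. \<bar>f x\<bar> \<le> c"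
    and linear_I: "linear_functional_on V I"
    and I_nonneg: "f \<in> V \<Longrightarrow> (\<And>x. 0 \<le> f x) \<Longrightarrow> 0 \<le> I f"
    and I_one: "I (\<lambda>x. 1) = 1"
    and I_continuous: "(\<And>n. F n \<in> V) \<Longrightarrow> decseq F \<Longrightarrow> (\<And>x. (\<lambda>n. F n x) \<longlonglongrightarrow> 0) \<Longrightarrow>
      (\<lambda>n. I (F n)) \<longlonglongrightarrow> 0"
begin

lemma add_in_V: "f \<in> V \<Longrightarrow> g \<in> V \<Longrightarrow> (\<lambda>x. f x + g x) \<in> V"
  using subspace_add[OF subspace_V, of f g] by (simp add: plus_fun_def)

lemma cmult_in_V: "f \<in> V \<Longrightarrow> (\<lambda>x. c * f x) \<in> V"
  using subspace_scale[OF subspace_V, of f c] by (simp add: scaleR_fun_def)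

lemma diff_in_V: "f \<in> V \<Longrightarrow> g \<in> V \<Longrightarrow> (\<lambda>x. f x - g x) \<in> V"
  using subspace_diff[OF subspace_V, of f g] by (simp add: fun_diff_def)

lemma const_in_V: "(\<lambda>x. c) \<in> V"
  using cmult_in_V[OF one_in_V, of c] by simp

lemma max_in_V:
  assumes "f \<in> V" "g \<in> V" shows "(\<lambda>x. max (f x) (g x)) \<in> V"
proof -
  have "(\<lambda>x. (f x + g x) - min (f x) (g x)) \<in> V"
    by (intro diff_in_V add_in_V min_in_V assms)
  also have "(\<lambda>x. (f x + g x) - min (f x) (g x)) = (\<lambda>x. max (f x) (g x))"
    by (auto simp: fun_eq_iff min_def max_def)
  finally show ?thesis .
qed

lemma sum_in_V:
  fixes F :: "nat \<Rightarrow> 'a \<Rightarrow> real"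
  shows "(\<And>i. F i \<in> V) \<Longrightarrow> (\<lambda>x. \<Sum>i<n. F i x) \<in> V"
  by (induction n) (auto intro: const_in_V add_in_V)

lemmas V_intros = add_in_V cmult_in_V diff_in_V const_in_V min_in_V max_in_V sum_in_V

lemma I_add: "f \<in> V \<Longrightarrow> g \<in> V \<Longrightarrow> I (\<lambda>x. f x + g x) = I f + I g"
  using linear_I unfolding linear_functional_on_def by (simp add: plus_fun_def)

lemma I_cmult: "f \<in> V \<Longrightarrow> I (\<lambda>x. c * f x) = c * I f"
  using linear_I unfolding linear_functional_on_def by (simp add: scaleR_fun_def)

lemma I_diff: "f \<in> V \<Longrightarrow> g \<in> V \<Longrightarrow> I (\<lambda>x. f x - g x) = I f - I g"
  using I_add[of f "\<lambda>x. (-1) * g x"] I_cmult[of g "-1"] cmult_in_V[of g "-1"] by simp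

lemma I_const: "I (\<lambda>x. c) = c"
  using I_cmult[OF one_in_V, of c] I_one by simp

lemma I_sum:
  fixes F :: "nat \<Rightarrow> 'a \<Rightarrow> real"
  shows "(\<And>i. F i \<in> V) \<Longrightarrow> I (\<lambda>x. \<Sum>i<n. F i x) = (\<Sum>i<n. I (F i))"
  by (induction n) (simp_all add: I_const I_add sum_in_V)

lemma I_mono: "f \<in> V \<Longrightarrow> g \<in> V \<Longrightarrow> (\<And>x. f x \<le> g x) \<Longrightarrow> I f \<le> I g"
  using I_nonneg[OF diff_in_V[of g f]] I_diff[of g f] by simp

section \<open>The outer measure of a Daniell integral\<close>

definition covers :: "'a set \<Rightarrow> (nat \<Rightarrow> 'a \<Rightarrow> real) set" where
  "covers A = {F. (\<forall>n. F n \<in> V) \<and> (\<forall>n x. 0 \<le> F n x) \<and> incseq F \<and> (\<forall>x\<in>A. \<exists>n. 1 \<le> F n x)}"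

text \<open>The supremum of a covering sequence dominates the indicator of \<open>A\<close>. Since
  this supremum need not lie in \<open>V\<close>, its integral is replaced by the supremum of the
  values of \<open>I\<close>.\<close>

definition outer :: "'a set \<Rightarrow> ennreal" where
  "outer A = (INF F\<in>covers A. SUP n. ennreal (I (F n)))"

definition level_sets :: "'a set set" where
  "level_sets = {{x. 0 < f x} | f. f \<in> V}"

text \<open>Truncations inside \<open>V\<close> that increase with \<open>k\<close> to the indicator
  of \<open>{x. 0 < f x}\<close>.\<close>

definition approx :: "('a \<Rightarrow> real) \<Rightarrow> nat \<Rightarrow> 'a \<Rightarrow> real" where
  "approx f k = (\<lambda>x. min 1 (real k * max 0 (f x)))"

lemma level_set_in_level_sets: "f \<in> V \<Longrightarrow> {x. 0 < f x} \<in> level_sets"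
  unfolding level_sets_def by blast

lemma approx_in_V: "f \<in> V \<Longrightarrow> approx f k \<in> V"
  unfolding approx_def by (intro V_intros)

lemma approx_nonneg: "0 \<le> approx f k x"
  by (simp add: approx_def)

lemma approx_le_1: "approx f k x \<le> 1"
  by (simp add: approx_def)

lemma approx_outside: "\<not> 0 < f x \<Longrightarrow> approx f k x = 0"
  by (simp add: approx_def max_def)

lemma incseq_approx: "incseq (approx f)"
  unfolding incseq_def le_fun_def approx_def
  by (intro allI impI min.mono[OF order_refl mult_right_mono]) auto

lemma approx_eventually_1: "0 < f x \<Longrightarrow> \<exists>k. approx f k x = 1"
proof -
  assume f: "0 < f x"
  obtain k where "1 / f x < real k" using reals_Archimedean2 by blast
  with f have "approx f k x = 1" by (simp add: approx_def field_simps)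
  then show ?thesis ..
qed

text \<open>The excess \<open>max 0 (g - F n)\<close> decreases to 0 pointwise, so its integral
  tends to 0, while \<open>I g\<close> is at most \<open>I (F n)\<close> plus that integral. This is
  where continuity of \<open>I\<close> at 0 enters.\<close>

lemma I_le_SUP:
  assumes g: "g \<in> V" and F: "\<And>n. F n \<in> V" "\<And>n x. 0 \<le> F n x" "incseq F"
    and le: "\<And>x. g x \<le> 0 \<or> (\<exists>n. g x \<le> F n x)"
  shows "ennreal (I g) \<le> (SUP n. ennreal (I (F n)))" (is "_ \<le> ?S")
proof -
  define h where "h = (\<lambda>n x. max 0 (g x - F n x))"
  have h: "h n \<in> V" for n unfolding h_def by (intro V_intros g F)
  have "(\<lambda>n. I (h n)) \<longlonglongrightarrow> 0"
  proof (rule I_continuous[OF h])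
    show "decseq h"
      using incseq_SucD[OF F(3)] unfolding h_def
      by (intro decseq_SucI le_funI max.mono diff_left_mono) (auto simp: le_fun_def)
    fix x
    obtain m where m: "g x - F m x \<le> 0"
      using le[of x] F(2)[of 0 x] by (metis diff_le_0_iff_le order_trans)
    have "g x - F n x \<le> 0" if "m \<le> n" for n
      using m that \<open>incseq F\<close> unfolding incseq_def le_fun_def by (metis diff_left_mono order_trans)
    then have "eventually (\<lambda>n. h n x = 0) sequentially"
      by (auto simp: eventually_sequentially h_def intro!: exI[of _ m] max_absorb1)
    then show "(\<lambda>n. h n x) \<longlonglongrightarrow> 0"
      by (simp add: tendsto_eventually)
  qed
  then have "(\<lambda>n. ?S + ennreal (I (h n))) \<longlonglongrightarrow> ?S + ennreal 0"
    by (intro tendsto_intros) auto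
  moreover have "ennreal (I g) \<le> ?S + ennreal (I (h n))" for n
  proof -
    have "I g \<le> I (\<lambda>x. F n x + h n x)"
      by (intro I_mono V_intros g F h) (simp add: h_def)
    also have "\<dots> = I (F n) + I (h n)" by (rule I_add[OF F(1) h])
    finally have "ennreal (I g) \<le> ennreal (I (F n) + I (h n))" by (rule ennreal_leI)
    also have "\<dots> = ennreal (I (F n)) + ennreal (I (h n))"
      by (intro ennreal_plus I_nonneg F h) (simp add: h_def)
    also have "\<dots> \<le> ?S + ennreal (I (h n))"
      by (intro add_right_mono SUP_upper) simp
    finally show ?thesis .
  qed
  ultimately have "ennreal (I g) \<le> ?S + ennreal 0"
    by (intro LIMSEQ_le_const) auto
  then show ?thesis by simp
qed

lemma outer_le: "F \<in> covers A \<Longrightarrow> outer A \<le> (SUP n. ennreal (I (F n)))"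
  unfolding outer_def by (rule INF_lower)

lemma approx_covers: "f \<in> V \<Longrightarrow> approx f \<in> covers {x. 0 < f x}"
  unfolding covers_def using approx_eventually_1[of f]
  by (auto intro!: approx_in_V approx_nonneg incseq_approx) (metis order_refl)

text \<open>The sequence \<open>approx f\<close> is an optimal cover: each of its members is at most
  1 and vanishes where \<open>f \<le> 0\<close>, so every other cover overtakes it pointwise and
  \<open>I_le_SUP\<close> applies.\<close>

lemma outer_level_set:
  assumes f: "f \<in> V"
  shows "outer {x. 0 < f x} = (SUP k. ennreal (I (approx f k)))"
proof (rule antisym)
  show "outer {x. 0 < f x} \<le> (SUP k. ennreal (I (approx f k)))"
    by (rule outer_le[OF approx_covers[OF f]])
  show "(SUP k. ennreal (I (approx f k))) \<le> outer {x. 0 < f x}"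
    unfolding outer_def
  proof (intro INF_greatest SUP_least)
    fix F k assume F: "F \<in> covers {x. 0 < f x}"
    show "ennreal (I (approx f k)) \<le> (SUP n. ennreal (I (F n)))"
    proof (rule I_le_SUP)
      fix x
      show "approx f k x \<le> 0 \<or> (\<exists>n. approx f k x \<le> F n x)"
      proof (cases "0 < f x")
        case True
        then obtain n where "1 \<le> F n x" using F unfolding covers_def by blast
        with approx_le_1[of f k x] show ?thesis by (meson order_trans)
      qed (simp add: approx_outside)
    qed (use F in \<open>auto simp: covers_def intro!: approx_in_V f\<close>)
  qed
qed

lemma outer_UNIV: "outer UNIV = 1"
proof (rule antisym)
  have "(\<lambda>n x. 1) \<in> covers UNIV"
    unfolding covers_def by (auto simp: one_in_V incseq_def le_fun_def)
  from outer_le[OF this] show "outer UNIV \<le> 1" by (simp add: I_one)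
  show "1 \<le> outer UNIV"
    unfolding outer_def
  proof (rule INF_greatest)
    fix F :: "nat \<Rightarrow> 'a \<Rightarrow> real" assume "F \<in> covers UNIV"
    then have "ennreal (I (\<lambda>x. 1)) \<le> (SUP n. ennreal (I (F n)))"
      by (intro I_le_SUP one_in_V) (auto simp: covers_def)
    then show "1 \<le> (SUP n. ennreal (I (F n)))" by (simp add: I_one)
  qed
qed

text \<open>Covers of the \<open>A i\<close> that are optimal up to \<open>e / 2^(i+1)\<close> are
  merged into a single cover of the union by diagonal sums.\<close>

lemma outer_countably_subadditive: "outer (\<Union>i. A i) \<le> (\<Sum>i. outer (A i))"
proof (rule ennreal_le_epsilon)
  fix e :: real assume e: "0 < e" and "(\<Sum>i. outer (A i)) < top"
  then have "outer (A i) < outer (A i) + e * (1/2) ^ Suc i" for i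
    by (auto simp add: less_top dest!: ennreal_suminf_lessD)
  then have "\<exists>F\<in>covers (A i). (SUP n. ennreal (I (F n))) < outer (A i) + e * (1/2) ^ Suc i" for i
    by (subst (asm) (1) outer_def) (simp add: INF_less_iff)
  then obtain F where F: "\<And>i. F i \<in> covers (A i)"
    and less: "\<And>i. (SUP n. ennreal (I (F i n))) < outer (A i) + e * (1/2) ^ Suc i"
    by metis
  have FV: "F i n \<in> V" and F0: "0 \<le> F i n x" and Finc: "incseq (F i)" for i n x
    using F[of i] unfolding covers_def by auto
  \<comment> \<open>Both the number of summands and the index within each cover grow with
    \<open>N\<close>, so each \<open>G N\<close> is a finite sum in \<open>V\<close>.\<close>
  define G where "G = (\<lambda>N x. \<Sum>i<N. F i N x)"
  have "G \<in> covers (\<Union>i. A i)"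
    unfolding covers_def
  proof (intro CollectI conjI allI ballI)
    show "G N \<in> V" for N unfolding G_def by (intro sum_in_V FV)
    show "0 \<le> G N x" for N x unfolding G_def by (intro sum_nonneg F0)
    show "incseq G"
    proof (intro incseq_SucI le_funI)
      fix N x
      have "G N x \<le> (\<Sum>i<N. F i (Suc N) x)"
        unfolding G_def using Finc by (intro sum_mono) (simp add: incseq_SucD le_funD)
      also have "\<dots> \<le> G (Suc N) x" unfolding G_def using F0 by simp
      finally show "G N x \<le> G (Suc N) x" .
    qed
    fix x assume "x \<in> (\<Union>i. A i)"
    then obtain i where "x \<in> A i" by blast
    then obtain n where n: "1 \<le> F i n x" using F[of i] unfolding covers_def by blast
    \<comment> \<open>The successor is needed because the sum runs over indices strictly below
      \<open>?N\<close> and has to contain the term \<open>i\<close>.\<close>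
    let ?N = "max n (Suc i)"
    have "F i n x \<le> F i ?N x" using Finc[of i] by (simp add: incseq_def le_fun_def)
    also have "\<dots> \<le> G ?N x" unfolding G_def by (rule member_le_sum) (use F0 in auto)
    finally show "\<exists>N. 1 \<le> G N x" using n by (meson order_trans)
  qed
  then have "outer (\<Union>i. A i) \<le> (SUP N. ennreal (I (G N)))" by (rule outer_le)
  also have "\<dots> \<le> (\<Sum>i. outer (A i) + e * (1/2) ^ Suc i)"
  proof (rule SUP_least)
    fix N
    have "ennreal (I (G N)) = (\<Sum>i<N. ennreal (I (F i N)))"
      unfolding G_def I_sum[OF FV] by (intro sum_ennreal[symmetric] I_nonneg FV F0)
    also have "\<dots> \<le> (\<Sum>i<N. outer (A i) + e * (1/2) ^ Suc i)"
    proof (rule sum_mono)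
      fix i
      have "ennreal (I (F i N)) \<le> (SUP n. ennreal (I (F i n)))" by (rule SUP_upper) simp
      with less[of i] show "ennreal (I (F i N)) \<le> outer (A i) + e * (1/2) ^ Suc i"
        by (meson le_less_trans less_imp_le)
    qed
    also have "\<dots> \<le> (\<Sum>i. outer (A i) + e * (1/2) ^ Suc i)"
      by (rule sum_le_suminf) auto
    finally show "ennreal (I (G N)) \<le> (\<Sum>i. outer (A i) + e * (1/2) ^ Suc i)" .
  qed
  also have "\<dots> = (\<Sum>i. outer (A i)) + (\<Sum>i. ennreal e * ennreal ((1/2) ^ Suc i))"
    using e by (subst suminf_add[symmetric])
      (auto simp del: ennreal_suminf_cmult simp add: ennreal_mult[symmetric])
  also have "\<dots> = (\<Sum>i. outer (A i)) + e"
    unfolding ennreal_suminf_cmult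
    by (subst suminf_ennreal_eq[OF zero_le_power power_half_series]) auto
  finally show "outer (\<Union>i. A i) \<le> (\<Sum>i. outer (A i)) + e" .
qed

lemma outer_measure_space_outer: "outer_measure_space (Pow UNIV) outer"
  unfolding outer_measure_space_def
proof (intro conjI)
  have "(\<lambda>n x. 0) \<in> covers {}"
    unfolding covers_def by (auto simp: const_in_V incseq_def)
  from outer_le[OF this] show "positive (Pow UNIV) outer"
    by (simp add: positive_def I_const)
  show "increasing (Pow UNIV) outer"
    unfolding increasing_def outer_def covers_def by (auto intro!: INF_superset_mono)
  show "countably_subadditive (Pow UNIV) outer"
    unfolding countably_subadditive_def using outer_countably_subadditive by blast
qed

text \<open>Caratheodory's condition. A cover \<open>F\<close> of \<open>A\<close> is split by the
  truncations of \<open>f\<close>: the minimum covers the part of \<open>A\<close> inside the level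
  set and the positive excess covers the part outside, while together they stay below
  \<open>F\<close>.\<close>

lemma level_set_in_lambda_system:
  assumes f: "f \<in> V"
  shows "{x. 0 < f x} \<in> lambda_system UNIV (Pow UNIV) outer" (is "?G \<in> _")
proof -
  have "outer (A \<inter> ?G) + outer (A - ?G) = outer A" for A
  proof (rule antisym)
    have "Measure_Space.subadditive (Pow UNIV) outer"
      using outer_measure_space_outer unfolding outer_measure_space_def
      by (metis ring_of_sets.countably_subadditive_subadditive ring_of_sets_Pow)
    from subadditiveD[OF this, of "A \<inter> ?G" "A - ?G"]
    have "outer ((A \<inter> ?G) \<union> (A - ?G)) \<le> outer (A \<inter> ?G) + outer (A - ?G)"
      by fastforce
    also have "(A \<inter> ?G) \<union> (A - ?G) = A" by blast
    finally show "outer A \<le> outer (A \<inter> ?G) + outer (A - ?G)" .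
    show "outer (A \<inter> ?G) + outer (A - ?G) \<le> outer A"
      unfolding outer_def[of A]
    proof (rule INF_greatest)
      fix F assume F: "F \<in> covers A"
      then have FV: "F n \<in> V" and F0: "0 \<le> F n x" and Fmono: "n \<le> m \<Longrightarrow> F n x \<le> F m x" for n m x
        unfolding covers_def incseq_def le_fun_def by auto
      let ?\<phi> = "approx f"
      \<comment> \<open>For fixed \<open>N\<close> the sequence \<open>?out N\<close> runs in
        \<open>M\<close>; the shift to \<open>M + N\<close> keeps \<open>F N\<close> below
        \<open>F (M + N)\<close>, so the two pieces sum to at most \<open>F (M + N)\<close>.\<close>
      let ?in = "\<lambda>N x. min (F N x) (?\<phi> N x)" and ?out = "\<lambda>N M x. max 0 (F (M + N) x - ?\<phi> N x)"
      have inV: "?in N \<in> V" and outV: "?out N M \<in> V" for N M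
        by (intro V_intros FV approx_in_V f)+
      have "?in \<in> covers (A \<inter> ?G)"
        unfolding covers_def
      proof (intro CollectI conjI allI ballI inV)
        show "incseq ?in"
          using incseq_approx[of f] Fmono unfolding incseq_def le_fun_def by (meson min.mono)
        fix x assume x: "x \<in> A \<inter> ?G"
        then obtain n where n: "1 \<le> F n x" using F unfolding covers_def by blast
        obtain k where k: "?\<phi> k x = 1" using approx_eventually_1 x by blast
        have "1 \<le> F (max n k) x" using n Fmono[of n "max n k" x] by simp
        moreover have "1 \<le> ?\<phi> (max n k) x"
          using k incseq_approx[of f] unfolding incseq_def le_fun_def by (metis max.cobounded2)
        ultimately show "\<exists>N. 1 \<le> ?in N x" by (metis min.boundedI)
      qed (simp add: F0 approx_nonneg)
      then have in_le: "outer (A \<inter> ?G) \<le> (SUP N. ennreal (I (?in N)))" by (rule outer_le)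
      have out_le: "outer (A - ?G) \<le> (SUP M. ennreal (I (?out N M)))" for N
      proof (rule outer_le)
        show "?out N \<in> covers (A - ?G)"
          unfolding covers_def
        proof (intro CollectI conjI allI ballI outV)
          show "incseq (?out N)"
            unfolding incseq_def le_fun_def by (intro allI impI max.mono diff_right_mono Fmono) auto
          fix x assume x: "x \<in> A - ?G"
          then obtain n where "1 \<le> F n x" using F unfolding covers_def by blast
          then have "1 \<le> F (n + N) x" using Fmono[of n "n + N" x] by simp
          moreover have "?\<phi> N x = 0" using x by (simp add: approx_outside)
          ultimately have "1 \<le> ?out N n x" by simp
          then show "\<exists>M. 1 \<le> ?out N M x" ..
        qed simp
      qed
      let ?S = "SUP n. ennreal (I (F n))"
      have *: "ennreal (I (?in N)) + ennreal (I (?out N M)) \<le> ?S" for N M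
      proof -
        have "ennreal (I (?in N)) + ennreal (I (?out N M)) = ennreal (I (?in N) + I (?out N M))"
          by (intro ennreal_plus[symmetric] I_nonneg inV outV) (simp_all add: F0 approx_nonneg)
        also have "I (?in N) + I (?out N M) = I (\<lambda>x. ?in N x + ?out N M x)"
          by (rule I_add[OF inV outV, symmetric])
        also have "\<dots> \<le> I (F (M + N))"
        proof (rule I_mono[OF add_in_V[OF inV outV] FV])
          fix x
          show "?in N x + ?out N M x \<le> F (M + N) x"
            using Fmono[of N "M + N" x] by (auto simp: min_def max_def)
        qed
        also have "ennreal (I (F (M + N))) \<le> ?S" by (rule SUP_upper) simp
        finally show ?thesis by (simp add: ennreal_leI)
      qed
      \<comment> \<open>The supremum over \<open>M\<close> is taken first, with \<open>N\<close>
        fixed, because the cover of \<open>A - ?G\<close> depends on \<open>N\<close>; the supremum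
        over \<open>N\<close> follows.\<close>
      have "ennreal (I (?in N)) + outer (A - ?G) \<le> ?S" for N
      proof -
        have "ennreal (I (?in N)) + outer (A - ?G) \<le> ennreal (I (?in N)) + (SUP M. ennreal (I (?out N M)))"
          by (intro add_left_mono out_le)
        also have "\<dots> = (SUP M. ennreal (I (?in N)) + ennreal (I (?out N M)))"
          by (rule ennreal_SUP_add_right) simp
        also have "\<dots> \<le> ?S" by (intro SUP_least *)
        finally show ?thesis .
      qed
      then have "(SUP N. ennreal (I (?in N)) + outer (A - ?G)) \<le> ?S" by (intro SUP_least)
      then have "(SUP N. ennreal (I (?in N))) + outer (A - ?G) \<le> ?S"
        by (simp add: ennreal_SUP_add_left)
      then show "outer (A \<inter> ?G) + outer (A - ?G) \<le> ?S"
        using add_right_mono[OF in_le] by (rule order_trans[rotated])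
    qed
  qed
  then show ?thesis
    unfolding algebra.lambda_system_eq[OF algebra_Pow] by simp
qed

section \<open>Integration against measures on the sigma-algebra of level sets\<close>

lemma measurable_level_sets:
  assumes P: "sets P = sigma_sets UNIV level_sets" and f: "f \<in> V"
  shows "f \<in> borel_measurable P"
proof (rule borel_measurableI_greater)
  fix a
  have "space P = UNIV"
    using sets_eq_imp_space_eq[of P "sigma UNIV level_sets"] P by simp
  \<comment> \<open>Subtracting a constant turns \<open>{f > a}\<close> into a level set.\<close>
  moreover have "{x. 0 < f x - a} \<in> level_sets"
    by (rule level_set_in_level_sets[OF diff_in_V[OF f const_in_V]])
  ultimately show "{x \<in> space P. a < f x} \<in> sets P"
    unfolding P by (auto intro: sigma_sets.Basic)
qed

lemma integrable_V:
  assumes "prob_space P" "sets P = sigma_sets UNIV level_sets" "f \<in> V"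
  shows "integrable P f"
proof -
  interpret prob_space P by fact
  obtain c where "\<And>x. \<bar>f x\<bar> \<le> c" using bounded_V[OF assms(3)] by blast
  then show ?thesis
    by (intro integrable_const_bound[of _ c] measurable_level_sets assms) auto
qed

text \<open>The layer cake decomposition: \<open>f\<close> is cut into \<open>n\<close> slices, and the slice above \<open>k / n\<close> is at
  most \<open>1 / n\<close> times the indicator of \<open>{f > k / n}\<close>.\<close>
lemma I_le_integral:
  assumes P: "prob_space P" and sets: "sets P = sigma_sets UNIV level_sets"
    and level: "\<And>f. f \<in> V \<Longrightarrow> emeasure P {x. 0 < f x} = (SUP k. ennreal (I (approx f k)))"
    and f: "f \<in> V" and f01: "\<And>x. 0 \<le> f x" "\<And>x. f x \<le> 1"
  shows "I f \<le> integral\<^sup>L P f"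
proof (rule field_le_epsilon)
  interpret prob_space P by fact
  have sp: "space P = UNIV"
    using sets_eq_imp_space_eq[of P "sigma UNIV level_sets"] sets by simp
  fix e :: real assume e: "0 < e"
  then obtain n where n: "1 / e < real n" using reals_Archimedean2 by blast
  have n0: "0 < real n" using n e by (metis divide_pos_pos order_less_trans zero_less_one)
  define G where "G = (\<lambda>k::nat. {x. real k / n < f x})"
  define s where "s = (\<lambda>k x. min (f x) (real (Suc k) / n) - min (f x) (real k / n))"
  have sV: "s k \<in> V" for k unfolding s_def by (intro V_intros f)
  have gV: "(\<lambda>x. f x - real k / n) \<in> V" for k by (intro V_intros f)
  have G: "G k = {x. 0 < f x - real k / n}" for k unfolding G_def by auto
  have Gs: "G k \<in> sets P" for k
    unfolding G sets by (intro sigma_sets.Basic level_set_in_level_sets gV)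
  have I_slice: "real n * I (s k) \<le> measure P (G k)" for k
  proof -
    \<comment> \<open>Scaled by \<open>n\<close>, a slice is the \<open>n\<close>-th truncation of
      \<open>f - k / n\<close>, and \<open>level\<close> bounds its integral by the measure of
      \<open>G k\<close>.\<close>
    have "real n * s k x = approx (\<lambda>x. f x - real k / n) n x" for x
    proof -
      have "real n * s k x = min (real n * f x) (real (Suc k)) - min (real n * f x) (real k)"
        using n0 by (simp add: s_def right_diff_distrib min_mult_distrib_left)
      also have "\<dots> = min 1 (max 0 (real n * f x - real k))"
        by (simp add: min_def max_def)
      also have "max 0 (real n * f x - real k) = real n * max 0 (f x - real k / n)"
        using n0 by (simp add: right_diff_distrib max_mult_distrib_left)
      finally show ?thesis by (simp add: approx_def)
    qed
    then have "(\<lambda>x. real n * s k x) = approx (\<lambda>x. f x - real k / n) n" ..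
    then have "ennreal (real n * I (s k)) = ennreal (I (approx (\<lambda>x. f x - real k / n) n))"
      by (simp add: I_cmult[OF sV, symmetric])
    also have "\<dots> \<le> emeasure P (G k)"
      unfolding G level[OF gV] by (rule SUP_upper) simp
    finally show ?thesis by (simp add: emeasure_eq_measure)
  qed
  have "I f = I f - I (\<lambda>x. 0)" by (simp add: I_const)
  \<comment> \<open>Since \<open>f\<close> takes values in [0, 1], truncation at height 1 gives
    \<open>f\<close> and at height 0 gives 0; the slices telescope between them.\<close>
  also have "\<dots> = I (\<lambda>x. min (f x) (real n / n)) - I (\<lambda>x. min (f x) (real 0 / n))"
    using n0 f01 by (simp add: min_absorb1 min_absorb2)
  also have "\<dots> = (\<Sum>k<n. I (\<lambda>x. min (f x) (real (Suc k) / n)) - I (\<lambda>x. min (f x) (real k / n)))"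
    by (rule sum_lessThan_telescope[symmetric])
  also have "\<dots> = (\<Sum>k<n. I (s k))"
    unfolding s_def by (intro sum.cong refl I_diff[symmetric] V_intros f)
  also have "\<dots> \<le> (\<Sum>k<n. measure P (G k) / n)"
    using I_slice n0 by (intro sum_mono) (simp add: field_simps)
  also have "\<dots> = (\<integral>x. (\<Sum>k<n. indicator (G k) x / n) \<partial>P)"
    using Gs by (subst Bochner_Integration.integral_sum)
      (auto simp: sp less_top[symmetric] intro!: integrable_real_indicator)
  also have "\<dots> \<le> (\<integral>x. f x + 1 / n \<partial>P)"
  proof (rule integral_mono)
    show "integrable P (\<lambda>x. \<Sum>k<n. indicator (G k) x / real n)"
      using Gs by (auto intro!: integrable_real_indicator emeasure_finite simp: less_top[symmetric])
    show "integrable P (\<lambda>x. f x + 1 / n)"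
      by (intro integrable_V P sets V_intros f)
    fix x
    \<comment> \<open>At each point the indicators count the levels below \<open>n * f x\<close>,
      which overshoots by at most one.\<close>
    have "(\<Sum>k<n. indicator (G k) x / real n) = real (card {k\<in>{..<n}. real k < real n * f x}) / n"
      using n0 by (simp add: G_def indicator_def sum_divide_distrib[symmetric] sum.If_cases
        divide_less_eq mult.commute Int_def)
    also have "\<dots> \<le> (real n * f x + 1) / n"
      using n0 f01 by (intro divide_right_mono card_real_less) auto
    also have "\<dots> = f x + 1 / n" using n0 by (simp add: field_simps)
    finally show "(\<Sum>k<n. indicator (G k) x / real n) \<le> f x + 1 / n" .
  qed
  also have "\<dots> = integral\<^sup>L P f + 1 / n"
    by (subst Bochner_Integration.integral_add) (auto intro!: integrable_V P sets f simp: prob_space)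
  also have "\<dots> \<le> integral\<^sup>L P f + e"
    using n n0 e by (simp add: field_simps)
  finally show "I f \<le> integral\<^sup>L P f + e" .
qed

text \<open>An affine map brings the bounded function \<open>f\<close> to a \<open>g\<close> with
  values in [0, 1]. The one-sided bound for \<open>g\<close> and for \<open>1 - g\<close> gives both
  inequalities.\<close>

lemma I_eq_integral:
  assumes P: "prob_space P" and sets: "sets P = sigma_sets UNIV level_sets"
    and level: "\<And>f. f \<in> V \<Longrightarrow> emeasure P {x. 0 < f x} = (SUP k. ennreal (I (approx f k)))"
    and f: "f \<in> V"
  shows "I f = integral\<^sup>L P f"
proof -
  interpret prob_space P by fact
  obtain c where c: "\<And>x. \<bar>f x\<bar> \<le> c" using bounded_V[OF f] by blast
  \<comment> \<open>A strictly positive bound, so that division by \<open>2 * d\<close> is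
    possible.\<close>
  define d where "d = \<bar>c\<bar> + 1"
  have d: "0 < d" "\<bar>f x\<bar> \<le> d" for x using c[of x] unfolding d_def by auto
  define g where "g = (\<lambda>x. (1 / (2 * d)) * (f x + d))"
  have gV: "g \<in> V" and gV': "(\<lambda>x. 1 - g x) \<in> V" unfolding g_def by (intro V_intros f)+
  have g01: "0 \<le> g x" "g x \<le> 1" for x
    using d(2)[of x] d(1) unfolding g_def by (auto simp: field_simps abs_le_iff)
  have "I g \<le> integral\<^sup>L P g"
    by (rule I_le_integral[OF P sets level gV g01])
  moreover have "I (\<lambda>x. 1 - g x) \<le> (\<integral>x. 1 - g x \<partial>P)"
    by (rule I_le_integral[OF P sets level gV']) (use g01 in auto)
  then have "1 - I g \<le> 1 - integral\<^sup>L P g"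
    using I_diff[OF one_in_V gV] integrable_V[OF P sets gV] by (simp add: I_one prob_space)
  ultimately have *: "I g = integral\<^sup>L P g" by simp
  have "f = (\<lambda>x. 2 * d * g x - d)"
    using d(1) by (simp add: g_def fun_eq_iff)
  moreover have "I (\<lambda>x. 2 * d * g x - d) = 2 * d * I g - d"
    by (subst I_diff) (auto intro!: V_intros gV simp: I_cmult[OF gV] I_const)
  moreover have "(\<integral>x. 2 * d * g x - d \<partial>P) = 2 * d * integral\<^sup>L P g - d"
    using integrable_V[OF P sets gV] by (simp add: prob_space)
  ultimately show ?thesis using * by metis
qed

text \<open>Monotone convergence along the truncations. For uniqueness: a representing measure is
  determined on level sets by \<open>I\<close> alone.\<close>

lemma emeasure_level_set:
  assumes P: "prob_space P" and sets: "sets P = sigma_sets UNIV level_sets"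
    and eq: "\<And>f. f \<in> V \<Longrightarrow> I f = integral\<^sup>L P f"
    and f: "f \<in> V"
  shows "emeasure P {x. 0 < f x} = (SUP k. ennreal (I (approx f k)))"
proof -
  have G: "{x. 0 < f x} \<in> sets P"
    unfolding sets by (intro sigma_sets.Basic level_set_in_level_sets f)
  have "(SUP k. ennreal (approx f k x)) = indicator {x. 0 < f x} x" for x
  proof (cases "0 < f x")
    case True
    then obtain k where "approx f k x = 1" using approx_eventually_1 by blast
    with approx_le_1 True show ?thesis
      by (intro antisym SUP_least SUP_upper2[of k]) auto
  qed (simp add: approx_outside)
  then have "emeasure P {x. 0 < f x} = (\<integral>\<^sup>+x. (SUP k. ennreal (approx f k x)) \<partial>P)"
    using G by simp
  also have "\<dots> = (SUP k. \<integral>\<^sup>+x. ennreal (approx f k x) \<partial>P)"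
    using incseq_approx[of f]
    by (intro nn_integral_monotone_convergence_SUP measurable_compose[OF _ measurable_ennreal]
        measurable_level_sets sets approx_in_V f)
      (auto simp: incseq_def le_fun_def intro!: ennreal_leI)
  also have "\<dots> = (SUP k. ennreal (I (approx f k)))"
    by (intro SUP_cong refl)
      (simp add: eq approx_in_V f nn_integral_eq_integral integrable_V[OF P sets] approx_nonneg)
  finally show ?thesis .
qed

text \<open>Existence: the level sets lie in the Caratheodory sigma-algebra of \<open>outer\<close>,
  so \<open>outer\<close> is a measure on what they generate. Uniqueness: the level sets form an
  intersection-stable generator, because \<open>V\<close> is closed under minima.\<close>

theorem daniell_stone:
  "\<exists>!P. prob_space P \<and> sets P = sigma_sets UNIV level_sets \<and> (\<forall>f\<in>V. I f = integral\<^sup>L P f)"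
proof (rule ex_ex1I)
  let ?S = "sigma_sets UNIV level_sets"
  define P where "P = measure_of UNIV ?S outer"
  interpret S: sigma_algebra UNIV ?S by (rule sigma_algebra_sigma_sets) simp
  have L: "measure_space UNIV (lambda_system UNIV (Pow UNIV) outer) outer"
    by (rule sigma_algebra.caratheodory_lemma[OF sigma_algebra_Pow outer_measure_space_outer])
  then have "?S \<subseteq> lambda_system UNIV (Pow UNIV) outer"
    using level_set_in_lambda_system
    by (intro sigma_algebra.sigma_sets_subset) (auto simp: measure_space_def level_sets_def)
  with L have "measure_space UNIV ?S outer"
    by (rule measure_down[OF _ S.sigma_algebra_axioms])
  then have emeasure: "emeasure P A = outer A" if "A \<in> ?S" for A
    unfolding P_def using that by (intro emeasure_measure_of_sigma) (auto simp: measure_space_def)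
  have sets: "sets P = ?S" and space: "space P = UNIV"
    unfolding P_def by (simp_all add: sigma_sets_sigma_sets_eq)
  have "prob_space P"
    by (rule prob_spaceI) (simp add: space emeasure outer_UNIV)
  moreover have "I f = integral\<^sup>L P f" if "f \<in> V" for f
    using \<open>prob_space P\<close> sets _ that
  proof (rule I_eq_integral)
    fix f assume f: "f \<in> V"
    then have "{x. 0 < f x} \<in> ?S" by (intro sigma_sets.Basic level_set_in_level_sets)
    then show "emeasure P {x. 0 < f x} = (SUP k. ennreal (I (approx f k)))"
      using outer_level_set[OF f] emeasure by simp
  qed
  ultimately show "\<exists>P. prob_space P \<and> sets P = ?S \<and> (\<forall>f\<in>V. I f = integral\<^sup>L P f)"
    using sets by blast
next
  let ?S = "sigma_sets UNIV level_sets"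
  fix P Q
  assume P: "prob_space P \<and> sets P = ?S \<and> (\<forall>f\<in>V. I f = integral\<^sup>L P f)"
    and Q: "prob_space Q \<and> sets Q = ?S \<and> (\<forall>f\<in>V. I f = integral\<^sup>L Q f)"
  show "P = Q"
  proof (rule measure_eqI_generator_eq)
    show "Int_stable level_sets"
      unfolding Int_stable_def
    proof (intro ballI)
      fix A B assume "A \<in> level_sets" "B \<in> level_sets"
      then obtain f g where "f \<in> V" "g \<in> V" "A = {x. 0 < f x}" "B = {x. 0 < g x}"
        unfolding level_sets_def by blast
      then have "A \<inter> B = {x. 0 < min (f x) (g x)}" "(\<lambda>x. min (f x) (g x)) \<in> V"
        by (auto intro: min_in_V)
      then show "A \<inter> B \<in> level_sets" using level_set_in_level_sets by metis
    qed
    show "level_sets \<subseteq> Pow UNIV" by simp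
    fix A assume "A \<in> level_sets"
    then obtain f where f: "f \<in> V" "A = {x. 0 < f x}" unfolding level_sets_def by blast
    show "emeasure P A = emeasure Q A"
      unfolding f(2) using emeasure_level_set[of P f] emeasure_level_set[of Q f] P Q f(1) by simp
  next
    show "sets P = ?S" "sets Q = ?S" using P Q by auto
    have "UNIV = {x. 0 < (\<lambda>x. 1::real) x}" by simp
    then show "range (\<lambda>i. UNIV) \<subseteq> level_sets"
      using level_set_in_level_sets[OF one_in_V] by simp
    show "emeasure P UNIV \<noteq> \<infinity>"
      using P by (metis finite_measure.emeasure_finite infinity_ennreal_def prob_space_imp_subprob_space subprob_space.axioms(1))
  qed simp
qed

end

section \<open>The extended real-valued integral\<close>

lemma ereal_integral_mono:
  assumes "\<And>y. f y \<le> g y"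
  shows "ereal_integral P f \<le> ereal_integral P g"
  unfolding ereal_integral_def
  by (intro ereal_minus_mono) (auto simp: less_eq_ennreal.rep_eq[symmetric] assms
      intro!: nn_integral_mono e2ennreal_mono)

lemma ereal_integral_ereal:
  assumes f: "integrable P f"
  shows "ereal_integral P (\<lambda>y. ereal (f y)) = ereal (integral\<^sup>L P f)"
proof -
  have "enn2ereal (\<integral>\<^sup>+ y. ennreal (g y) \<partial>P) = ereal (enn2real (\<integral>\<^sup>+ y. ennreal (g y) \<partial>P))"
    if "integrable P g" for g
  proof -
    have "(\<integral>\<^sup>+ y. ennreal (g y) \<partial>P) \<le> (\<integral>\<^sup>+ y. ennreal (norm (g y)) \<partial>P)"
      by (intro nn_integral_mono ennreal_leI) simp
    also have "\<dots> < \<infinity>" using that by (simp add: integrable_iff_bounded)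
    finally show ?thesis
      by (cases "\<integral>\<^sup>+ y. ennreal (g y) \<partial>P" rule: ennreal_cases) auto
  qed
  from this[OF f] this[of "\<lambda>y. - f y"] f show ?thesis
    by (simp add: ereal_integral_def real_lebesgue_integral_def)
qed

text \<open>In \<open>ereal\<close>, \<open>\<infinity> - \<infinity> = \<infinity>\<close>, so an
  infinite positive part always yields the value \<open>\<infinity>\<close>.\<close>

lemma ereal_integral_less_top:
  "ereal_integral P f < \<infinity> \<Longrightarrow> (\<integral>\<^sup>+ y. e2ennreal (f y) \<partial>P) < \<infinity>"
  unfolding ereal_integral_def
  by (cases "\<integral>\<^sup>+ y. e2ennreal (f y) \<partial>P" rule: ennreal_cases) auto

text \<open>Decomposing \<open>a\<close>, \<open>b\<close> and \<open>a + b\<close> into positive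
  and negative parts and moving all negative parts across leaves an identity without subtraction,
  which survives infinite values and can be integrated.\<close>

lemma e2ennreal_add_cancel:
  assumes "meaningful a b"
  shows "e2ennreal (a + b) + e2ennreal (- a) + e2ennreal (- b)
    = e2ennreal (- (a + b)) + e2ennreal a + e2ennreal b"
proof -
  have *: "ennreal (x + y) + ennreal (- x) + ennreal (- y) = ennreal (- (x + y)) + ennreal x + ennreal y"
    for x y :: real
  proof -
    have pos: "ennreal z = ennreal (max 0 z)" for z by (simp add: max_def ennreal_neg)
    show ?thesis
      unfolding pos[of "x + y"] pos[of "- x"] pos[of "- y"] pos[of "- (x + y)"] pos[of x] pos[of y]
      by (simp flip: ennreal_plus del: ennreal_max_0 ennreal_max_0')
  qed
  show ?thesis
    using assms *
    by (cases a; cases b) (auto simp: meaningful_def)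
qed

text \<open>The subtraction-free identity between positive and negative parts is integrated. Both
  integrals being below \<open>\<infinity>\<close>, all positive parts have finite integral, so
  these can be cancelled even if negative parts are infinite.\<close>

lemma ereal_integral_add:
  assumes [measurable]: "f \<in> borel_measurable P" "g \<in> borel_measurable P"
    and fin: "ereal_integral P f < \<infinity>" "ereal_integral P g < \<infinity>"
    and m: "meaningful_fun f g"
  shows "ereal_integral P (\<lambda>y. f y + g y) = ereal_integral P f + ereal_integral P g"
proof -
  let ?N = "\<lambda>h. \<integral>\<^sup>+ y. e2ennreal (h y) \<partial>P"
  have "(\<integral>\<^sup>+ y. e2ennreal (f y + g y) + e2ennreal (- f y) + e2ennreal (- g y) \<partial>P)
    = (\<integral>\<^sup>+ y. e2ennreal (- (f y + g y)) + e2ennreal (f y) + e2ennreal (g y) \<partial>P)"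
    using m by (intro nn_integral_cong e2ennreal_add_cancel) (simp add: meaningful_fun_def)
  then have eq: "?N (\<lambda>y. f y + g y) + ?N (\<lambda>y. - f y) + ?N (\<lambda>y. - g y)
    = ?N (\<lambda>y. - (f y + g y)) + ?N f + ?N g"
    by (simp add: nn_integral_add)
  have "e2ennreal (a + b) \<le> e2ennreal a + e2ennreal b" for a b
  proof -
    have "ennreal (x + y) \<le> ennreal x + ennreal y" for x y :: real
    proof -
      have "ennreal (x + y) \<le> ennreal (max 0 x + max 0 y)"
        by (intro ennreal_leI add_mono) auto
      also have "\<dots> = ennreal x + ennreal y" by (subst ennreal_plus) auto
      finally show ?thesis .
    qed
    then show ?thesis by (cases a; cases b) (auto simp: e2ennreal_neg)
  qed
  then have "?N (\<lambda>y. f y + g y) \<le> (\<integral>\<^sup>+ y. e2ennreal (f y) + e2ennreal (g y) \<partial>P)"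
    by (intro nn_integral_mono) simp
  then have le: "?N (\<lambda>y. f y + g y) \<le> ?N f + ?N g"
    by (simp add: nn_integral_add)
  have fin': "?N f < \<infinity>" "?N g < \<infinity>" using fin ereal_integral_less_top by auto
  then have "?N (\<lambda>y. f y + g y) < \<infinity>" using le by (simp add: le_less_trans)
  moreover have "\<exists>r\<ge>0. x = ennreal r" if "x < \<infinity>" for x
    using that by (cases x rule: ennreal_cases) auto
  ultimately obtain a b c where N: "?N f = ennreal a" "?N g = ennreal b" "?N (\<lambda>y. f y + g y) = ennreal c"
    "0 \<le> a" "0 \<le> b" "0 \<le> c"
    using fin' by meson
  \<comment> \<open>If \<open>X\<close> or \<open>Y\<close> is infinite then so is \<open>Z\<close>,
    and both sides are \<open>-\<infinity>\<close>; otherwise all six terms are real.\<close>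
  have *: "enn2ereal (ennreal c) - enn2ereal Z = (enn2ereal (ennreal a) - enn2ereal X) + (enn2ereal (ennreal b) - enn2ereal Y)"
    if eq: "ennreal c + X + Y = Z + ennreal a + ennreal b" for X Y Z
  proof (cases "X = top \<or> Y = top")
    case True
    with eq have "Z = top" by (metis ennreal_add_eq_top ennreal_neq_top)
    with True N(4-) show ?thesis by (cases X; cases Y) auto
  next
    case False
    then obtain x y where xy: "X = ennreal x" "Y = ennreal y" "0 \<le> x" "0 \<le> y"
      by (metis ennreal_cases)
    with eq have "Z \<noteq> top" by (metis ennreal_add_eq_top ennreal_neq_top)
    then obtain z where z: "Z = ennreal z" "0 \<le> z" by (metis ennreal_cases)
    from eq have "ennreal (c + x + y) = ennreal (z + a + b)"
      using xy z N(4-) by simp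
    then have "c + x + y = z + a + b"
      using xy z N(4-) by (subst (asm) ennreal_inj) auto
    then show ?thesis using xy z N(4-) by simp
  qed
  show ?thesis
    unfolding ereal_integral_def N by (rule *[OF eq[unfolded N]])
qed

lemma ereal_integral_cmult:
  assumes [measurable]: "f \<in> borel_measurable P" and c: "0 \<le> c"
  shows "ereal_integral P (\<lambda>y. ereal c * f y) = ereal c * ereal_integral P f"
proof -
  have *: "e2ennreal (ereal c * x) = ennreal c * e2ennreal x" for x
    using c by (cases x; cases "c = 0") (auto simp: ennreal_mult' ennreal_top_mult ennreal_mult_top zero_ereal_def[symmetric] e2ennreal_neg)
  have **: "e2ennreal (- (ereal c * x)) = ennreal c * e2ennreal (- x)" for x
    using *[of "- x"] by simp
  have "ereal_integral P (\<lambda>y. ereal c * f y) = ereal c * enn2ereal (\<integral>\<^sup>+ y. e2ennreal (f y) \<partial>P)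
    - ereal c * enn2ereal (\<integral>\<^sup>+ y. e2ennreal (- f y) \<partial>P)"
    unfolding ereal_integral_def * **
    using c by (simp add: nn_integral_cmult times_ennreal.rep_eq enn2ereal_ennreal)
  also have "\<dots> = ereal c * ereal_integral P f"
    unfolding ereal_integral_def using c
    by (cases "\<integral>\<^sup>+ y. e2ennreal (f y) \<partial>P" rule: ennreal_cases;
        cases "\<integral>\<^sup>+ y. e2ennreal (- f y) \<partial>P" rule: ennreal_cases; cases "c = 0")
      (auto simp: enn2ereal_ennreal right_diff_distrib zero_ereal_def[symmetric])
  finally show ?thesis .
qed

lemma ereal_integral_linear:
  assumes [measurable]: "f \<in> borel_measurable P" "g \<in> borel_measurable P"
    and fin: "ereal_integral P f < \<infinity>" "ereal_integral P g < \<infinity>"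
    and ab: "0 \<le> a" "0 \<le> b" and m: "meaningful_fun (\<lambda>y. ereal a * f y) (\<lambda>y. ereal b * g y)"
  shows "ereal_integral P (\<lambda>y. ereal a * f y + ereal b * g y)
    = ereal a * ereal_integral P f + ereal b * ereal_integral P g"
proof -
  have "ereal c * x < \<infinity>" if "0 \<le> c" "x < \<infinity>" for c :: real and x
    using that by (cases x; cases "c = 0") auto
  then show ?thesis
    using ereal_integral_add[of "\<lambda>y. ereal a * f y" P "\<lambda>y. ereal b * g y"] fin ab m
    by (simp add: ereal_integral_cmult)
qed

text \<open>Positive parts converge monotonically; negative parts decrease and are dominated by that
  of \<open>F 0\<close>, whose finite integral also excludes
  \<open>\<infinity> - \<infinity>\<close> in the limit.\<close>

lemma ereal_integral_monotone_convergence: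
  assumes F: "\<And>n. F n \<in> borel_measurable P" "incseq F" "\<And>y. (\<lambda>n. F n y) \<longlonglongrightarrow> f y"
    and fin: "(\<integral>\<^sup>+ y. e2ennreal (- F 0 y) \<partial>P) < \<infinity>"
  shows "(\<lambda>n. ereal_integral P (F n)) \<longlonglongrightarrow> ereal_integral P f"
proof -
  have [measurable]: "F n \<in> borel_measurable P" for n by (rule F)
  have [measurable]: "f \<in> borel_measurable P"
    by (rule borel_measurable_LIMSEQ_order[OF F(3) F(1)])
  have mono: "F m y \<le> F n y" if "m \<le> n" for m n y
    using F(2) that by (simp add: incseq_def le_fun_def)
  have Ff: "F n y \<le> f y" for n y
    using F(3)[of y] by (rule incseq_le[rotated]) (auto simp: incseq_def mono)
  have "(\<lambda>n. \<integral>\<^sup>+ y. e2ennreal (F n y) \<partial>P) \<longlonglongrightarrow> (\<integral>\<^sup>+ y. e2ennreal (f y) \<partial>P)"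
    by (intro nn_integral_LIMSEQ tendsto_e2ennrealI F(3))
      (auto simp: incseq_def le_fun_def intro!: e2ennreal_mono mono)
  moreover have "(\<lambda>n. \<integral>\<^sup>+ y. e2ennreal (- F n y) \<partial>P) \<longlonglongrightarrow> (\<integral>\<^sup>+ y. e2ennreal (- f y) \<partial>P)"
    by (rule nn_integral_dominated_convergence[where w = "\<lambda>y. e2ennreal (- F 0 y)"])
      (auto intro!: e2ennreal_mono mono tendsto_e2ennrealI F(3) simp: fin[unfolded infinity_ennreal_def])
  moreover have "(\<integral>\<^sup>+ y. e2ennreal (- f y) \<partial>P) \<le> (\<integral>\<^sup>+ y. e2ennreal (- F 0 y) \<partial>P)"
    by (intro nn_integral_mono e2ennreal_mono) (simp add: Ff)
  then have "enn2ereal (\<integral>\<^sup>+ y. e2ennreal (- f y) \<partial>P) \<noteq> \<infinity>"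
    using fin by (metis enn2ereal_eq_top_iff infinity_ennreal_def leD top.not_eq_extremum)
  moreover have "enn2ereal x \<noteq> - \<infinity>" for x
    using enn2ereal_nonneg[of x] by auto
  ultimately show ?thesis
    unfolding ereal_integral_def
    by (intro tendsto_diff_ereal_general tendsto_enn2erealI) auto
qed

section \<open>The extension of a convex expectation\<close>

lemma meaningful_ereal [simp]: "meaningful (ereal a) (ereal b)"
  by (simp add: meaningful_def)

lemma meaningful_fun_ereal [simp]: "meaningful_fun (\<lambda>y. ereal (u y)) (\<lambda>y. ereal (v y))"
  by (simp add: meaningful_fun_def)

lemma convex_functionalD:
  assumes "convex_functional G \<Phi>" "f \<in> G" "g \<in> G" "0 \<le> l" "l \<le> 1"
    "meaningful_fun (\<lambda>y. ereal l * f y) (\<lambda>y. ereal (1 - l) * g y)"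
    "(\<lambda>y. ereal l * f y + ereal (1 - l) * g y) \<in> G"
    "meaningful (ereal l * \<Phi> f) (ereal (1 - l) * \<Phi> g)"
  shows "\<Phi> (\<lambda>y. ereal l * f y + ereal (1 - l) * g y) \<le> ereal l * \<Phi> f + ereal (1 - l) * \<Phi> g"
  using assms unfolding convex_functional_def by simp

lemma additive_functionalD:
  assumes "additive_functional G \<Phi>" "f \<in> G" "g \<in> G" "meaningful_fun f g" "(\<lambda>y. f y + g y) \<in> G"
    "meaningful (\<Phi> f) (\<Phi> g)"
  shows "\<Phi> (\<lambda>y. f y + g y) = \<Phi> f + \<Phi> g"
  using assms unfolding additive_functional_def by simp

lemma homogeneousD:
  assumes "homogeneous G \<Phi>" "f \<in> G" "(\<lambda>y. ereal c * f y) \<in> G"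
  shows "\<Phi> (\<lambda>y. ereal c * f y) = ereal c * \<Phi> f"
  using assms unfolding homogeneous_def by simp

lemma positively_homogeneousD:
  assumes "positively_homogeneous G \<Phi>" "f \<in> G" "0 \<le> c" "(\<lambda>y. ereal c * f y) \<in> G"
  shows "\<Phi> (\<lambda>y. ereal c * f y) = ereal c * \<Phi> f"
  using assms unfolding positively_homogeneous_def by simp

lemma downward_continuous_onD:
  assumes "downward_continuous_on C G \<Phi>" "\<And>n. F n \<in> C" "f \<in> C" "decreases_to F f"
  shows "(\<lambda>n. \<Phi> (F n)) \<longlonglongrightarrow> \<Phi> f"
  using assms unfolding downward_continuous_on_def by simp

lemma decreases_toD: "decreases_to F f \<Longrightarrow> m \<le> n \<Longrightarrow> F n y \<le> F m y"
  unfolding decreases_to_def by (blast dest: decseqD le_funD)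

lemma decreases_to_lower:
  assumes "decreases_to F f" shows "f y \<le> F n y"
proof (rule decseq_ge)
  show "decseq (\<lambda>n. F n y)"
    unfolding decseq_def by (intro allI impI decreases_toD[OF assms])
  show "(\<lambda>n. F n y) \<longlonglongrightarrow> f y" using assms unfolding decreases_to_def by blast
qed

locale continuous_convex_expectation =
  fixes D :: "('y \<Rightarrow> ereal) set" and \<E> :: "('y \<Rightarrow> ereal) \<Rightarrow> ereal"
  assumes D_bounded: "D \<subseteq> bounded_real_functions"
    and D_linear: "linear_space_of_real_functions D"
    and D_const: "(\<lambda>y. ereal c) \<in> D"
    and D_min: "f \<in> D \<Longrightarrow> g \<in> D \<Longrightarrow> (\<lambda>y. min (f y) (g y)) \<in> D"
    and \<E>_convex: "convex_expectation D \<E>"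
    and \<E>_continuous: "downward_continuous D \<E>"
begin

section \<open>Passage from \<open>D\<close> to a vector space of real-valued functions\<close>

abbreviation er :: "('y \<Rightarrow> real) \<Rightarrow> 'y \<Rightarrow> ereal" where
  "er u \<equiv> (\<lambda>y. ereal (u y))"

text \<open>A copy of \<open>D\<close> in a real vector space, as Hahn--Banach and Daniell--Stone
  require; extended reals do not form one.\<close>

definition V :: "('y \<Rightarrow> real) set" where
  "V = {u. er u \<in> D}"

text \<open>The conversion would send infinite values to 0, but nonlinear expectations are finite on
  \<open>D\<close>.\<close>

definition restr :: "(('y \<Rightarrow> ereal) \<Rightarrow> ereal) \<Rightarrow> ('y \<Rightarrow> real) \<Rightarrow> real" where
  "restr \<Phi> u = real_of_ereal (\<Phi> (er u))"

definition lift :: "(('y \<Rightarrow> real) \<Rightarrow> real) \<Rightarrow> ('y \<Rightarrow> ereal) \<Rightarrow> ereal" where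
  "lift L f = ereal (L (\<lambda>y. real_of_ereal (f y)))"

lemma restr_lift [simp]: "restr (lift L) = L"
  by (simp add: restr_def lift_def fun_eq_iff)

lemma in_V_iff: "u \<in> V \<longleftrightarrow> er u \<in> D"
  by (simp add: V_def)

lemma D_finite: "f \<in> D \<Longrightarrow> \<bar>f y\<bar> \<noteq> \<infinity>"
  and D_add: "f \<in> D \<Longrightarrow> g \<in> D \<Longrightarrow> (\<lambda>y. f y + g y) \<in> D"
  and D_cmult: "f \<in> D \<Longrightarrow> (\<lambda>y. ereal c * f y) \<in> D"
  using D_linear unfolding linear_space_of_real_functions_def by simp_all

lemma D_cases:
  assumes "f \<in> D" obtains u where "u \<in> V" "f = er u"
proof
  show *: "f = er (\<lambda>y. real_of_ereal (f y))"
    using D_finite[OF assms] by (simp add: fun_eq_iff ereal_real')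
  show "(\<lambda>y. real_of_ereal (f y)) \<in> V" using assms * by (simp add: in_V_iff)
qed

lemma ball_D: "(\<forall>f\<in>D. Q f) \<longleftrightarrow> (\<forall>u\<in>V. Q (er u))"
proof
  assume Q: "\<forall>u\<in>V. Q (er u)"
  show "\<forall>f\<in>D. Q f"
  proof
    fix f assume "f \<in> D"
    then obtain u where "u \<in> V" "f = er u" by (rule D_cases)
    with Q show "Q f" by simp
  qed
qed (simp add: in_V_iff)

lemma subspace_V: "subspace V"
  unfolding subspace_def
proof (intro conjI ballI allI)
  show "0 \<in> V" using D_const[of 0] by (simp add: in_V_iff)
next
  fix u v assume "u \<in> V" "v \<in> V"
  then have "(\<lambda>y. er u y + er v y) \<in> D" unfolding in_V_iff by (rule D_add)
  then show "u + v \<in> V" by (simp add: in_V_iff)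
next
  fix c u assume "u \<in> V"
  then have "(\<lambda>y. ereal c * er u y) \<in> D" unfolding in_V_iff by (rule D_cmult)
  then show "c *\<^sub>R u \<in> V" by (simp add: in_V_iff)
qed

lemma bounded_V:
  assumes "u \<in> V" shows "\<exists>c. \<forall>y. \<bar>u y\<bar> \<le> c"
proof -
  have "er u \<in> bounded_real_functions" using assms D_bounded by (auto simp: in_V_iff)
  then show ?thesis by (auto simp: bounded_real_functions_def)
qed

lemma const_in_V: "(\<lambda>y. c) \<in> V"
  using D_const by (simp add: in_V_iff)

lemma min_in_V: "u \<in> V \<Longrightarrow> v \<in> V \<Longrightarrow> (\<lambda>y. min (u y) (v y)) \<in> V"
  using D_min[of "er u" "er v"] by (simp add: in_V_iff ereal_min)

text \<open>A bounded function lies between two constants, and these are reproduced by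
  \<open>\<Phi>\<close>.\<close>

lemma nonlinear_expectation_finite:
  assumes \<Phi>: "nonlinear_expectation D \<Phi>" and u: "u \<in> V"
  shows "\<Phi> (er u) = ereal (restr \<Phi> u)"
proof -
  obtain c where c: "\<And>y. \<bar>u y\<bar> \<le> c" using bounded_V[OF u] by blast
  have iso: "\<Phi> f \<le> \<Phi> g" if "f \<in> D" "g \<in> D" "f \<le> g" for f g
    using \<Phi> that unfolding nonlinear_expectation_def isotone_def by blast
  have const: "\<Phi> (\<lambda>y. ereal k) = ereal k" for k
    using \<Phi> unfolding nonlinear_expectation_def by blast
  have "\<Phi> (\<lambda>y. ereal (- c)) \<le> \<Phi> (er u)" "\<Phi> (er u) \<le> \<Phi> (\<lambda>y. ereal c)"
    using u c by (auto intro!: iso D_const simp: in_V_iff le_fun_def abs_le_iff)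
      (metis abs_le_iff minus_le_iff)
  then show ?thesis
    unfolding const restr_def by (cases "\<Phi> (er u)") auto
qed

lemma restr_mono:
  assumes "nonlinear_expectation D \<Phi>" "u \<in> V" "v \<in> V" "\<And>y. u y \<le> v y"
  shows "restr \<Phi> u \<le> restr \<Phi> v"
proof -
  have "\<Phi> (er u) \<le> \<Phi> (er v)"
    using assms unfolding nonlinear_expectation_def isotone_def in_V_iff by (simp add: le_fun_def)
  then show ?thesis using assms by (simp add: nonlinear_expectation_finite)
qed

lemma restr_const:
  "nonlinear_expectation D \<Phi> \<Longrightarrow> restr \<Phi> (\<lambda>y. c) = c"
  unfolding nonlinear_expectation_def restr_def by simp

lemma \<E>_nonlinear: "nonlinear_expectation D \<E>"
  using \<E>_convex unfolding convex_expectation_def by blast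

lemma \<E>_er: "u \<in> V \<Longrightarrow> \<E> (er u) = ereal (restr \<E> u)"
  by (rule nonlinear_expectation_finite[OF \<E>_nonlinear])

lemma convex_on_restr_\<E>: "convex_on V (restr \<E>)"
  unfolding convex_on_def
proof (intro conjI ballI allI impI subspace_imp_convex subspace_V)
  fix u v and a b :: real
  assume uv: "u \<in> V" "v \<in> V" and ab: "0 \<le> a" "0 \<le> b" "a + b = 1"
  have w: "a *\<^sub>R u + b *\<^sub>R v \<in> V"
    using uv by (intro subspace_add subspace_scale subspace_V)
  have b: "b = 1 - a" using ab by simp
  have eq: "(\<lambda>y. ereal a * er u y + ereal (1 - a) * er v y) = er (a *\<^sub>R u + b *\<^sub>R v)"
    by (simp add: b)
  have "\<E> (\<lambda>y. ereal a * er u y + ereal (1 - a) * er v y) \<le> ereal a * \<E> (er u) + ereal (1 - a) * \<E> (er v)"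
  proof (rule convex_functionalD)
    show "convex_functional D \<E>" using \<E>_convex unfolding convex_expectation_def by blast
    show "(\<lambda>y. ereal a * er u y + ereal (1 - a) * er v y) \<in> D"
      unfolding eq using w by (rule in_V_iff[THEN iffD1])
    show "er u \<in> D" "er v \<in> D" using uv unfolding in_V_iff by this+
  qed (use uv ab in \<open>simp_all add: \<E>_er\<close>)
  then show "restr \<E> (a *\<^sub>R u + b *\<^sub>R v) \<le> a * restr \<E> u + b * restr \<E> v"
    unfolding eq \<E>_er[OF w] \<E>_er[OF uv(1)] \<E>_er[OF uv(2)] by (simp add: b)
qed

lemma restr_\<E>_continuous:
  assumes "\<And>n. U n \<in> V" "u \<in> V" "decseq U" "\<And>y. (\<lambda>n. U n y) \<longlonglongrightarrow> u y"
  shows "(\<lambda>n. restr \<E> (U n)) \<longlonglongrightarrow> restr \<E> u"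
proof -
  have "decreases_to (\<lambda>n. er (U n)) (er u)"
    using decseq_SucD[OF assms(3)] assms(4) unfolding decreases_to_def
    by (intro conjI decseq_SucI) (simp_all add: le_fun_def)
  then have "(\<lambda>n. \<E> (er (U n))) \<longlonglongrightarrow> \<E> (er u)"
    by (rule downward_continuous_onD[OF \<E>_continuous, rotated -1]) (use assms in \<open>simp_all add: in_V_iff\<close>)
  then show ?thesis using assms by (simp add: \<E>_er)
qed

lemma linear_expectation_nonlinear: "linear_expectation D E \<Longrightarrow> nonlinear_expectation D E"
  unfolding linear_expectation_def upper_expectation_def sublinear_expectation_def by blast

lemma linear_functional_on_restr:
  assumes E: "linear_expectation D E"
  shows "linear_functional_on V (restr E)"
  unfolding linear_functional_on_def
proof (intro conjI ballI allI)
  note fin = nonlinear_expectation_finite[OF linear_expectation_nonlinear[OF E]]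
  fix u assume u: "u \<in> V"
  {
    fix v assume v: "v \<in> V"
    have w: "u + v \<in> V" by (rule subspace_add[OF subspace_V u v])
    have eq: "(\<lambda>y. er u y + er v y) = er (u + v)" by simp
    have "additive_functional D E" using E unfolding linear_expectation_def by blast
    then have "E (\<lambda>y. er u y + er v y) = E (er u) + E (er v)"
      by (rule additive_functionalD) (use u v w in \<open>simp_all add: fin\<close>, simp_all add: in_V_iff)
    then show "restr E (u + v) = restr E u + restr E v"
      unfolding eq fin[OF u] fin[OF v] fin[OF w] by simp
  }
  fix c
  have w: "c *\<^sub>R u \<in> V" by (rule subspace_scale[OF subspace_V u])
  have eq: "(\<lambda>y. ereal c * er u y) = er (c *\<^sub>R u)" by simp
  have "homogeneous D E" using E unfolding linear_expectation_def by blast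
  then have "E (\<lambda>y. ereal c * er u y) = ereal c * E (er u)"
    by (rule homogeneousD) (use u w in \<open>simp_all add: in_V_iff\<close>)
  then show "restr E (c *\<^sub>R u) = c * restr E u"
    unfolding eq fin[OF u] fin[OF w] by simp
qed

text \<open>Turns a functional supplied by Hahn--Banach into a linear expectation; isotony is
  positivity applied to a difference.\<close>

lemma linear_expectation_lift:
  assumes L: "linear_functional_on V L" and nonneg: "\<And>u. u \<in> V \<Longrightarrow> (\<And>y. 0 \<le> u y) \<Longrightarrow> 0 \<le> L u"
    and one: "L (\<lambda>y. 1) = 1"
  shows "linear_expectation D (lift L)"
proof -
  have add: "lift L (\<lambda>y. f y + g y) = lift L f + lift L g" if "f \<in> D" "g \<in> D" for f g
  proof -
    obtain u where u: "u \<in> V" "f = er u" by (rule D_cases[OF \<open>f \<in> D\<close>])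
    obtain v where v: "v \<in> V" "g = er v" by (rule D_cases[OF \<open>g \<in> D\<close>])
    note uv = u v
    then have "L (u + v) = L u + L v" using L unfolding linear_functional_on_def by blast
    then show ?thesis by (simp add: uv lift_def plus_fun_def)
  qed
  have cmult: "lift L (\<lambda>y. ereal c * f y) = ereal c * lift L f" if f: "f \<in> D" for f c
  proof -
    obtain u where u: "u \<in> V" "f = er u" by (rule D_cases[OF f])
    then have "L (c *\<^sub>R u) = c * L u" using L unfolding linear_functional_on_def by blast
    then show ?thesis by (simp add: u lift_def scaleR_fun_def)
  qed
  have "lift L f \<le> lift L g" if "f \<in> D" "g \<in> D" "f \<le> g" for f g
  proof -
    obtain u where u: "u \<in> V" "f = er u" by (rule D_cases[OF \<open>f \<in> D\<close>])
    obtain v where v: "v \<in> V" "g = er v" by (rule D_cases[OF \<open>g \<in> D\<close>])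
    note uv = u v
    have d: "v - u \<in> V" by (rule subspace_diff[OF subspace_V uv(3,1)])
    have "0 \<le> L (v - u)"
      using \<open>f \<le> g\<close> by (intro nonneg d) (simp add: uv le_fun_def)
    moreover have "L (u + (v - u)) = L u + L (v - u)"
      using L uv d unfolding linear_functional_on_def by blast
    ultimately show ?thesis by (simp add: uv lift_def)
  qed
  moreover have "lift L (\<lambda>y. ereal c) = ereal c" for c
    using cmult[OF D_const, of c 1] by (simp add: lift_def one)
  ultimately have "nonlinear_expectation D (lift L)"
    unfolding nonlinear_expectation_def isotone_def by (simp add: D_const)
  then show ?thesis
    unfolding linear_expectation_def upper_expectation_def sublinear_expectation_def
      subadditive_def positively_homogeneous_def homogeneous_def additive_functional_def
    by (simp add: add cmult D_linear)
qed

section \<open>Linear expectations with finite conjugate and their measures\<close>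

definition admissible :: "(('y \<Rightarrow> ereal) \<Rightarrow> ereal) set" where
  "admissible = {E \<in> linear_expectations D. conjugate D \<E> E < \<infinity>}"

lemma admissible_linear: "E \<in> admissible \<Longrightarrow> linear_expectation D E"
  unfolding admissible_def linear_expectations_def by blast

lemma conjugate_le_iff:
  assumes E: "linear_expectation D E"
  shows "conjugate D \<E> E \<le> ereal c \<longleftrightarrow> (\<forall>u\<in>V. restr E u - restr \<E> u \<le> c)"
proof -
  have "conjugate D \<E> E \<le> ereal c \<longleftrightarrow> (\<forall>f\<in>D. E f - \<E> f \<le> ereal c)"
    unfolding conjugate_def by (rule SUP_le_iff)
  also have "\<dots> \<longleftrightarrow> (\<forall>u\<in>V. E (er u) - \<E> (er u) \<le> ereal c)"
    by (rule ball_D)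
  also have "\<dots> \<longleftrightarrow> (\<forall>u\<in>V. restr E u - restr \<E> u \<le> c)"
    by (simp add: \<E>_er nonlinear_expectation_finite[OF linear_expectation_nonlinear[OF E]])
  finally show ?thesis .
qed

text \<open>Tested with the zero function. In particular the conjugate is never
  \<open>-\<infinity>\<close>, so it is real for admissible \<open>E\<close>.\<close>

lemma conjugate_nonneg:
  assumes E: "linear_expectation D E" shows "0 \<le> conjugate D \<E> E"
proof -
  have "E (\<lambda>y. ereal 0) - \<E> (\<lambda>y. ereal 0) \<le> conjugate D \<E> E"
    unfolding conjugate_def using D_const by (rule SUP_upper)
  moreover have "E (\<lambda>y. ereal 0) = ereal 0" "\<E> (\<lambda>y. ereal 0) = ereal 0"
    using linear_expectation_nonlinear[OF E] \<E>_nonlinear unfolding nonlinear_expectation_def by blast+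
  ultimately show ?thesis by simp
qed

lemma admissible_conjugate:
  assumes "E \<in> admissible"
  obtains c where "0 \<le> c" "conjugate D \<E> E = ereal c" "\<And>u. u \<in> V \<Longrightarrow> restr E u - restr \<E> u \<le> c"
proof -
  note E = admissible_linear[OF assms]
  obtain c where c: "conjugate D \<E> E = ereal c" "0 \<le> c"
    using conjugate_nonneg[OF E] assms unfolding admissible_def
    by (cases "conjugate D \<E> E") auto
  with conjugate_le_iff[OF E, of c] that show thesis by auto
qed

text \<open>Finiteness of the conjugate transfers downward continuity at 0 from \<open>\<E>\<close>
  to \<open>E\<close>; the other requirements are properties of \<open>D\<close> and of linear
  expectations.\<close>

lemma daniell_admissible:
  assumes "E \<in> admissible"
  shows "daniell_integral V (restr E)"
proof
  note E = admissible_linear[OF assms]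
  note nl = linear_expectation_nonlinear[OF E]
  obtain c where c: "0 \<le> c" "\<And>u. u \<in> V \<Longrightarrow> restr E u - restr \<E> u \<le> c"
    using admissible_conjugate[OF assms] by metis
  show "subspace V" "(\<lambda>y. 1) \<in> V" by (fact subspace_V const_in_V)+
  show "(\<lambda>y. min (f y) (g y)) \<in> V" if "f \<in> V" "g \<in> V" for f g by (rule min_in_V[OF that])
  show "\<exists>c. \<forall>y. \<bar>f y\<bar> \<le> c" if "f \<in> V" for f by (rule bounded_V[OF that])
  show linear: "linear_functional_on V (restr E)" by (rule linear_functional_on_restr[OF E])
  show nonneg: "0 \<le> restr E f" if "f \<in> V" "\<And>y. 0 \<le> f y" for f
    using restr_mono[OF nl const_in_V that(1), of 0] that(2) restr_const[OF nl, of 0] by simp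
  show "restr E (\<lambda>y. 1) = 1" by (rule restr_const[OF nl])
  fix F assume F: "\<And>n. F n \<in> V" "decseq F" "\<And>y. (\<lambda>n. F n y) \<longlonglongrightarrow> 0"
  have F0: "0 \<le> F n y" for n y
    using decseqD[OF F(2)] by (intro decseq_ge[OF _ F(3)[of y]]) (simp add: decseq_def le_fun_def)
  show "(\<lambda>n. restr E (F n)) \<longlonglongrightarrow> 0"
  proof (rule LIMSEQ_I)
    fix e :: real assume e: "0 < e"
    \<comment> \<open>Testing the bound of \<open>E\<close> against a large multiple of \<open>F n\<close> makes the penalty \<open>c\<close> negligible.\<close>
    define k where "k = (c + 1) / e"
    have k: "0 < k" using c(1) e by (simp add: k_def)
    have kF: "k *\<^sub>R F n \<in> V" for n by (rule subspace_scale[OF subspace_V F(1)])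
    have "(\<lambda>n. restr \<E> (k *\<^sub>R F n)) \<longlonglongrightarrow> restr \<E> (\<lambda>y. 0)"
    proof (rule restr_\<E>_continuous[OF kF const_in_V])
      show "decseq (\<lambda>n. k *\<^sub>R F n)"
        using decseq_SucD[OF F(2)] k by (intro decseq_SucI) (simp add: le_fun_def)
      show "(\<lambda>n. (k *\<^sub>R F n) y) \<longlonglongrightarrow> 0" for y
        using tendsto_mult[OF tendsto_const[of k] F(3)[of y]] by simp
    qed
    then have "eventually (\<lambda>n. restr \<E> (k *\<^sub>R F n) < 1) sequentially"
      by (rule order_tendstoD) (simp add: restr_const[OF \<E>_nonlinear])
    then obtain N where N: "\<And>n. N \<le> n \<Longrightarrow> restr \<E> (k *\<^sub>R F n) < 1"
      unfolding eventually_sequentially by blast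
    have "norm (restr E (F n) - 0) < e" if "N \<le> n" for n
    proof -
      have "k * restr E (F n) = restr E (k *\<^sub>R F n)"
        using linear F(1) unfolding linear_functional_on_def by simp
      also have "\<dots> < c + 1"
        using c(2)[OF kF[of n]] N[OF that] by linarith
      also have "\<dots> = k * e" using e by (simp add: k_def)
      finally have "restr E (F n) < e" using k by simp
      then show ?thesis using nonneg[OF F(1) F0, of n] by simp
    qed
    then show "\<exists>N. \<forall>n\<ge>N. norm (restr E (F n) - 0) < e" by (intro exI allI impI)
  qed
qed

lemma sets_sigma_of:
  assumes "daniell_integral V I"
  shows "sets (sigma_of D) = sigma_sets UNIV (daniell_integral.level_sets V)"
proof -
  interpret daniell_integral V I by fact
  have "sigma_sets UNIV {f -` B |f B. f \<in> D \<and> B \<in> sets borel} = sigma_sets UNIV level_sets"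
  proof (rule sigma_sets_eqI)
    fix A assume "A \<in> {f -` B |f B. f \<in> D \<and> B \<in> sets borel}"
    then obtain f B where f: "f \<in> D" "B \<in> sets borel" "A = f -` B" by blast
    then obtain u where u: "u \<in> V" "f = er u" using D_cases[OF f(1)] by metis
    have "u \<in> borel_measurable (sigma UNIV level_sets)"
      by (rule measurable_level_sets[OF _ u(1)]) simp
    then have "f \<in> borel_measurable (sigma UNIV level_sets)"
      unfolding u(2) by simp
    from measurable_sets[OF this f(2)] show "A \<in> sigma_sets UNIV level_sets"
      by (simp add: f(3))
  next
    fix A assume "A \<in> level_sets"
    then obtain u where u: "u \<in> V" "A = {x. 0 < u x}" unfolding level_sets_def by blast
    then have "A = er u -` {0<..}" by auto
    with u(1) show "A \<in> sigma_sets UNIV {f -` B |f B. f \<in> D \<and> B \<in> sets borel}"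
      unfolding in_V_iff
      by (intro sigma_sets.Basic CollectI exI[of _ "er u"] exI[of _ "{0<..}"] conjI) auto
  qed
  then show ?thesis unfolding sigma_of_def by simp
qed

text \<open>On admissible \<open>E\<close>, representation in the sense of \<open>represents\<close>
  is that of Daniell--Stone, whose unique existence justifies the definite description in
  \<open>repr_measure\<close>.\<close>

lemma represents_repr_measure:
  assumes E: "E \<in> admissible"
  shows "represents D E (repr_measure D E)"
proof -
  note nl = linear_expectation_nonlinear[OF admissible_linear[OF E]]
  interpret daniell_integral V "restr E" by (rule daniell_admissible[OF E])
  have iff: "represents D E P \<longleftrightarrow>
    prob_space P \<and> sets P = sigma_sets UNIV level_sets \<and> (\<forall>u\<in>V. restr E u = integral\<^sup>L P u)" for P
    unfolding represents_def sets_sigma_of[OF daniell_admissible[OF E]] ball_D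
  proof (intro conj_cong ball_cong refl)
    fix u assume "prob_space P" "sets P = sigma_sets UNIV level_sets" "u \<in> V"
    then show "E (er u) = ereal_integral P (er u) \<longleftrightarrow> restr E u = integral\<^sup>L P u"
      using integrable_V nonlinear_expectation_finite[OF nl] by (simp add: ereal_integral_ereal)
  qed
  have "\<exists>!P. represents D E P" unfolding iff by (rule daniell_stone)
  then show ?thesis unfolding repr_measure_def by (rule theI')
qed

lemma prob_space_repr_measure: "E \<in> admissible \<Longrightarrow> prob_space (repr_measure D E)"
  and sets_repr_measure: "E \<in> admissible \<Longrightarrow> sets (repr_measure D E) = sets (sigma_of D)"
  and integral_repr_measure: "E \<in> admissible \<Longrightarrow> f \<in> D \<Longrightarrow> ereal_integral (repr_measure D E) f = E f"
  using represents_repr_measure[of E] unfolding represents_def by simp_all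

lemma borel_measurable_repr_measure:
  "E \<in> admissible \<Longrightarrow> f \<in> borel_measurable (sigma_of D) \<Longrightarrow> f \<in> borel_measurable (repr_measure D E)"
  by (simp add: measurable_cong_sets[OF sets_repr_measure refl])

section \<open>The extension and the dual representation on \<open>D\<close>\<close>

lemma extension_eq:
  "extension D \<E> f = (SUP E\<in>admissible. ereal_integral (repr_measure D E) f - conjugate D \<E> E)"
  unfolding extension_def admissible_def ..

lemma extension_upper:
  "E \<in> admissible \<Longrightarrow> ereal_integral (repr_measure D E) f - conjugate D \<E> E \<le> extension D \<E> f"
  unfolding extension_eq by (rule SUP_upper)

lemma extension_mono:
  assumes "\<And>y. f y \<le> g y" shows "extension D \<E> f \<le> extension D \<E> g"
  unfolding extension_eq by (intro SUP_mono') (intro ereal_minus_mono ereal_integral_mono assms order_refl)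

text \<open>Replaces the usual compactness argument: a single \<open>E\<close> works for the whole sequence.\<close>
lemma exists_admissible:
  assumes U: "\<And>n. U n \<in> V" "decseq U" "\<And>n y. c \<le> U n y"
    and l: "(\<lambda>n. restr \<E> (U n)) \<longlonglongrightarrow> l"
  obtains E where "E \<in> admissible" "\<And>n. ereal l \<le> E (er (U n)) - conjugate D \<E> E"
proof -
  let ?e = "restr \<E>"
  note mono = restr_mono[OF \<E>_nonlinear] and const = restr_const[OF \<E>_nonlinear]
  \<comment> \<open>As \<open>U\<close> decreases, this infimum is the limit of
    \<open>?e (h + U n)\<close>; the lower bound \<open>c\<close> of \<open>U\<close> keeps it
    finite.\<close>
  define q where "q h = (INF n. ?e (h + U n))" for h
  have hU: "h + U n \<in> V" if "h \<in> V" for h n by (rule subspace_add[OF subspace_V that U(1)])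
  have low: "\<exists>d. \<forall>n. d \<le> ?e (h + U n)" if h: "h \<in> V" for h
  proof -
    obtain k where k: "\<And>y. \<bar>h y\<bar> \<le> k" using bounded_V[OF h] by blast
    have "- k + c \<le> (h + U n) y" for n y
      using U(3)[of n y] k[of y] by simp
    then have "?e (\<lambda>y. - k + c) \<le> ?e (h + U n)" for n
      by (intro mono const_in_V hU h)
    then show ?thesis unfolding const by blast
  qed
  then have bdd: "bdd_below (range (\<lambda>n. ?e (h + U n)))" if "h \<in> V" for h
    using that by (meson bdd_belowI2)
  have dec: "decseq (\<lambda>n. ?e (h + U n))" if h: "h \<in> V" for h
    using decseq_SucD[OF U(2)] by (intro decseq_SucI mono hU h) (simp add: le_fun_def)
  have lim: "(\<lambda>n. ?e (h + U n)) \<longlonglongrightarrow> q h" if "h \<in> V" for h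
    unfolding q_def by (rule LIMSEQ_decseq_INF[OF bdd dec]) (use that in auto)
  have q_le: "q h \<le> ?e (h + U n)" if "h \<in> V" for h n
    unfolding q_def by (rule cINF_lower[OF bdd[OF that]]) simp
  have zero: "0 \<in> V" by (rule subspace_0[OF subspace_V])
  have q0: "q 0 = l" using LIMSEQ_unique[OF lim[OF zero]] l by simp
  have "convex_on V (\<lambda>h. q h - l)"
    unfolding convex_on_def
  proof (intro conjI ballI allI impI subspace_imp_convex subspace_V)
    fix g h and a b :: real
    assume gh: "g \<in> V" "h \<in> V" and ab: "0 \<le> a" "0 \<le> b" "a + b = 1"
    have "q (a *\<^sub>R g + b *\<^sub>R h) \<le> a * q g + b * q h"
    proof (rule LIMSEQ_le)
      show "(\<lambda>n. ?e ((a *\<^sub>R g + b *\<^sub>R h) + U n)) \<longlonglongrightarrow> q (a *\<^sub>R g + b *\<^sub>R h)"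
        by (intro lim subspace_add subspace_scale subspace_V gh)
      show "(\<lambda>n. a * ?e (g + U n) + b * ?e (h + U n)) \<longlonglongrightarrow> a * q g + b * q h"
        by (intro tendsto_intros lim gh)
      have "?e ((a *\<^sub>R g + b *\<^sub>R h) + U n) \<le> a * ?e (g + U n) + b * ?e (h + U n)" for n
      proof -
        \<comment> \<open>Because \<open>a + b = 1\<close>, the shift by \<open>U n\<close>
          distributes over the convex combination, and convexity passes from \<open>?e\<close> to
          \<open>q\<close>.\<close>
        have "(a *\<^sub>R g + b *\<^sub>R h) + (a + b) *\<^sub>R U n = a *\<^sub>R (g + U n) + b *\<^sub>R (h + U n)"
          by (simp only: scaleR_add_right scaleR_add_left ac_simps)
        then have "(a *\<^sub>R g + b *\<^sub>R h) + U n = a *\<^sub>R (g + U n) + b *\<^sub>R (h + U n)"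
          using ab by simp
        then show ?thesis
          using convex_on_restr_\<E> hU gh ab unfolding convex_on_def by metis
      qed
      then show "\<exists>N. \<forall>n\<ge>N. ?e ((a *\<^sub>R g + b *\<^sub>R h) + U n) \<le> a * ?e (g + U n) + b * ?e (h + U n)"
        by blast
    qed
    moreover have "a * l + b * l = l" using ab by (metis distrib_right mult_1)
    ultimately show "q (a *\<^sub>R g + b *\<^sub>R h) - l \<le> a * (q g - l) + b * (q h - l)"
      by (simp add: right_diff_distrib)
  qed
  then obtain L where L: "linear_functional_on V L" and L_le: "\<And>h. h \<in> V \<Longrightarrow> L h \<le> q h - l"
    using hahn_banach_convex[OF subspace_V, of "\<lambda>h. q h - l"] q0 by auto
  have L_scale: "L (k *\<^sub>R h) = k * L h" if "h \<in> V" for k h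
    using L that unfolding linear_functional_on_def by blast
  have nonneg: "0 \<le> L u" if u: "u \<in> V" "\<And>y. 0 \<le> u y" for u
  proof -
    have nu: "- u \<in> V" by (rule subspace_neg[OF subspace_V u(1)])
    \<comment> \<open>Shifting down by a nonnegative \<open>u\<close> can only lower the limit, so
      \<open>L (- u) \<le> 0\<close>.\<close>
    have "q (- u) \<le> l"
    proof (rule LIMSEQ_le_const[OF l])
      have "q (- u) \<le> ?e (U n)" for n
      proof -
        have "?e (- u + U n) \<le> ?e (U n)"
          by (rule mono[OF hU[OF nu] U(1)]) (simp add: u)
        with q_le[OF nu, of n] show ?thesis by linarith
      qed
      then show "\<exists>N. \<forall>n\<ge>N. q (- u) \<le> ?e (U n)" by blast
    qed
    then show ?thesis using L_le[OF nu] L_scale[OF u(1), of "-1"] by simp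
  qed
  \<comment> \<open>The product \<open>t * (L 1 - 1)\<close> is bounded above by
    \<open>k - l\<close> for every real \<open>t\<close> of either sign, which forces
    \<open>L 1 = 1\<close>.\<close>
  have one: "L (\<lambda>y. 1) = 1"
  proof (rule ccontr)
    obtain k where k: "\<And>y. \<bar>U 0 y\<bar> \<le> k" using bounded_V[OF U(1)] by blast
    have *: "t * (L (\<lambda>y. 1) - 1) \<le> k - l" for t
    proof -
      have t: "(\<lambda>y. t) \<in> V" by (rule const_in_V)
      have "L (\<lambda>y. t) \<le> ?e ((\<lambda>y. t) + U 0) - l"
        using L_le[OF t] q_le[OF t, of 0] by linarith
      also have "?e ((\<lambda>y. t) + U 0) \<le> ?e (\<lambda>y. t + k)"
      proof (rule mono[OF hU[OF t] const_in_V])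
        show "((\<lambda>y. t) + U 0) y \<le> t + k" for y using k[of y] by simp
      qed
      also have "\<dots> = t + k" by (rule const)
      also have "L (\<lambda>y. t) = t * L (\<lambda>y. 1)"
        using L_scale[OF const_in_V, of t 1] by (simp add: scaleR_fun_def)
      finally show ?thesis by (simp add: algebra_simps)
    qed
    assume "L (\<lambda>y. 1) \<noteq> 1"
    \<comment> \<open>For this \<open>t\<close> the left side equals
      \<open>k - l + 1\<close>.\<close>
    with *[of "(k - l + 1) / (L (\<lambda>y. 1) - 1)"] show False by simp
  qed
  have lin: "linear_expectation D (lift L)"
    by (rule linear_expectation_lift[OF L nonneg one])
  \<comment> \<open>Applying \<open>L h \<le> ?e (h + U n) - l\<close> to \<open>h = u - U n\<close>
    bounds every \<open>L u - ?e u\<close> by the same number; read the other way, this is the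
    desired lower bound by \<open>l\<close>.\<close>
  have conj: "conjugate D \<E> (lift L) \<le> ereal (L (U n) - l)" for n
    unfolding conjugate_le_iff[OF lin] restr_lift
  proof
    fix u assume u: "u \<in> V"
    have d: "u - U n \<in> V" by (rule subspace_diff[OF subspace_V u U(1)])
    have "L ((u - U n) + U n) = L (u - U n) + L (U n)"
      using L d U(1) unfolding linear_functional_on_def by blast
    then have "L u = L (u - U n) + L (U n)" by simp
    moreover have "L (u - U n) \<le> ?e ((u - U n) + U n) - l"
      using L_le[OF d] q_le[OF d, of n] by linarith
    ultimately show "L u - ?e u \<le> L (U n) - l" by simp
  qed
  show thesis
  proof
    show "lift L \<in> admissible"
      unfolding admissible_def linear_expectations_def using lin conj[of 0]
      by (auto intro: le_less_trans)
    fix n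
    have "lift L (er (U n)) = ereal (L (U n))" by (simp add: lift_def)
    then show "ereal l \<le> lift L (er (U n)) - conjugate D \<E> (lift L)"
      using conj[of n] conjugate_nonneg[OF lin] by (cases "conjugate D \<E> (lift L)") auto
  qed
qed

text \<open>The definition of the conjugate gives one inequality; a constant sequence in
  \<open>exists_admissible\<close> gives an \<open>E\<close> attaining the other.\<close>

lemma extension_D:
  assumes f: "f \<in> D" shows "extension D \<E> f = \<E> f"
proof -
  obtain u where u: "u \<in> V" "f = er u" by (rule D_cases[OF f])
  show ?thesis
  proof (rule antisym)
    show "extension D \<E> f \<le> \<E> f"
      unfolding extension_eq
    proof (rule SUP_least)
      fix E assume E: "E \<in> admissible"
      obtain c where c: "conjugate D \<E> E = ereal c" "restr E u - restr \<E> u \<le> c"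
        using admissible_conjugate[OF E] u(1) by metis
      have "E f = ereal (restr E u)"
        unfolding u(2) using E u(1)
        by (intro nonlinear_expectation_finite linear_expectation_nonlinear admissible_linear)
      then show "ereal_integral (repr_measure D E) f - conjugate D \<E> E \<le> \<E> f"
        using c \<E>_er[OF u(1)] by (simp add: integral_repr_measure[OF E f] u(2)[symmetric])
    qed
    obtain k where k: "\<And>y. \<bar>u y\<bar> \<le> k" using bounded_V[OF u(1)] by blast
    obtain E where E: "E \<in> admissible" "ereal (restr \<E> u) \<le> E (er u) - conjugate D \<E> E"
    proof (rule exists_admissible[of "\<lambda>n. u" "- k" "restr \<E> u"])
      show "- k \<le> u y" for y using k[of y] by linarith
    qed (use u in \<open>auto simp: decseq_def\<close>)
    have "\<E> f = ereal (restr \<E> u)" using \<E>_er[OF u(1)] u(2) by simp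
    also have "\<dots> \<le> ereal_integral (repr_measure D E) f - conjugate D \<E> E"
      using E(2) by (simp add: integral_repr_measure[OF E(1) f] u(2)[symmetric])
    also have "\<dots> \<le> extension D \<E> f" by (rule extension_upper[OF E(1)])
    finally show "\<E> f \<le> extension D \<E> f" .
  qed
qed

section \<open>Measurable functions and convexity of the extension\<close>

lemma measurable_D: "f \<in> D \<Longrightarrow> f \<in> borel_measurable (sigma_of D)"
  unfolding sigma_of_def by (intro measurableI) auto

lemma bounded_in_M_below:
  assumes "f \<in> borel_measurable (sigma_of D)" "f \<in> bounded_real_functions"
  shows "f \<in> M_below D"
proof -
  obtain c :: real where c: "\<And>y. \<bar>f y\<bar> \<le> ereal c" using assms(2) by (auto simp: bounded_real_functions_def)
  have "ereal (- c) \<le> f y" for y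
    using c[of y] by (cases "f y") auto
  then have "ereal (- c) \<le> (INF y. f y)" by (rule INF_greatest)
  then have "- \<infinity> < (INF y. f y)" by (rule less_le_trans[rotated]) simp
  with assms(1) show ?thesis by (simp add: M_below_def)
qed

lemma D_subset_M_all: "D \<subseteq> M_all D"
  using bounded_in_M_below[OF measurable_D] D_bounded unfolding M_all_def by blast

lemma M_all_measurable: "f \<in> M_all D \<Longrightarrow> f \<in> borel_measurable (sigma_of D)"
  unfolding M_all_def M_below_def M_above_def by blast

lemma D_delta_b_subset: "D_delta_b D \<subseteq> M_all D"
proof
  fix f assume "f \<in> D_delta_b D"
  then obtain F where F: "f \<in> bounded_real_functions" "\<And>n. F n \<in> D" "decreases_to F f"
    unfolding D_delta_b_def by blast
  have "(\<lambda>n. F n y) \<longlonglongrightarrow> f y" for y using F(3) unfolding decreases_to_def by blast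
  from borel_measurable_LIMSEQ_order[OF this measurable_D[OF F(2)]]
  have "f \<in> borel_measurable (sigma_of D)" .
  then show "f \<in> M_all D" using bounded_in_M_below F(1) unfolding M_all_def by blast
qed

lemma nonlinear_expectation_extension: "nonlinear_expectation (M_all D) (extension D \<E>)"
  unfolding nonlinear_expectation_def isotone_def
proof (intro conjI ballI allI impI)
  show "extension D \<E> f \<le> extension D \<E> g" if "f \<le> g" for f g
    using that by (intro extension_mono) (simp add: le_fun_def)
  fix c :: real
  show "(\<lambda>y. ereal c) \<in> M_all D" using D_subset_M_all D_const by blast
  show "extension D \<E> (\<lambda>y. ereal c) = ereal c"
    using extension_D[OF D_const] \<E>_nonlinear unfolding nonlinear_expectation_def by simp
qed

text \<open>The conjugate of an admissible \<open>E\<close> is real, so subtracting it cannot hide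
  an infinite integral. This supplies the finiteness needed for additivity of the integral.\<close>

lemma integral_less_top:
  assumes "E \<in> admissible" "extension D \<E> f \<noteq> \<infinity>"
  shows "ereal_integral (repr_measure D E) f < \<infinity>"
proof -
  obtain c where "conjugate D \<E> E = ereal c" using admissible_conjugate[OF assms(1)] by metis
  with extension_upper[OF assms(1), of f] assms(2) show ?thesis
    by (cases "ereal_integral (repr_measure D E) f") auto
qed

text \<open>For each admissible \<open>E\<close> the integral minus a constant is affine in the
  function, and a supremum of affine functionals is convex.\<close>

lemma convex_extension: "convex_functional (M_all D) (extension D \<E>)"
  unfolding convex_functional_def
proof (intro ballI allI impI)
  let ?X = "extension D \<E>"
  fix f g and l :: real
  assume fg: "f \<in> M_all D" "g \<in> M_all D" and l: "0 \<le> l" "l \<le> 1"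
    and m: "meaningful_fun (\<lambda>y. ereal l * f y) (\<lambda>y. ereal (1 - l) * g y)"
  \<comment> \<open>At the endpoints \<open>0 * \<infinity> = 0\<close> removes one term. Strictly
    inside, an infinite value of \<open>?X f\<close> or \<open>?X g\<close> makes the right side
    \<open>\<infinity>\<close>, since in \<open>ereal\<close> this absorbs even
    \<open>-\<infinity>\<close>.\<close>
  consider "l = 0" | "l = 1" | "0 < l" "l < 1" using l by linarith
  then show "?X (\<lambda>y. ereal l * f y + ereal (1 - l) * g y) \<le> ereal l * ?X f + ereal (1 - l) * ?X g"
  proof cases
    case 3
    show ?thesis
    proof (cases "?X f = \<infinity> \<or> ?X g = \<infinity>")
      case True
      with 3 show ?thesis by auto
    next
      case False
      show ?thesis
        unfolding extension_eq[of "\<lambda>y. ereal l * f y + ereal (1 - l) * g y"]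
      proof (rule SUP_least)
        fix E assume E: "E \<in> admissible"
        let ?P = "repr_measure D E"
        obtain c where c: "conjugate D \<E> E = ereal c" using admissible_conjugate[OF E] by metis
        have fin: "ereal_integral ?P f < \<infinity>" "ereal_integral ?P g < \<infinity>"
          using integral_less_top[OF E] False by auto
        have "ereal_integral ?P (\<lambda>y. ereal l * f y + ereal (1 - l) * g y)
          = ereal l * ereal_integral ?P f + ereal (1 - l) * ereal_integral ?P g"
          using l fg fin m
          by (intro ereal_integral_linear borel_measurable_repr_measure[OF E] M_all_measurable) auto
        also have "\<dots> - ereal c = ereal l * (ereal_integral ?P f - ereal c) + ereal (1 - l) * (ereal_integral ?P g - ereal c)"
          using fin 3 by (cases "ereal_integral ?P f"; cases "ereal_integral ?P g")
            (auto simp: algebra_simps)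
        also have "\<dots> \<le> ereal l * ?X f + ereal (1 - l) * ?X g"
          using extension_upper[OF E] l unfolding c
          by (intro add_mono ereal_mult_left_mono) auto
        finally show "ereal_integral ?P (\<lambda>y. ereal l * f y + ereal (1 - l) * g y) - conjugate D \<E> E
          \<le> ereal l * ?X f + ereal (1 - l) * ?X g" by (simp add: c)
      qed
    qed
  qed (simp_all add: zero_ereal_def[symmetric] one_ereal_def[symmetric])
qed

section \<open>Downward and upward continuity\<close>

lemma decreasing_limit_of_D:
  assumes G: "\<And>n. G n \<in> D" "decreases_to G f" and f: "f \<in> bounded_real_functions"
  shows "(\<lambda>n. \<E> (G n)) \<longlonglongrightarrow> extension D \<E> f"
proof -
  obtain k :: real where k: "\<And>y. \<bar>f y\<bar> \<le> ereal k" using f by (auto simp: bounded_real_functions_def)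
  note G_dec = decreases_toD[OF G(2)] and fG = decreases_to_lower[OF G(2)]
  have G_lim: "(\<lambda>n. G n y) \<longlonglongrightarrow> f y" for y using G(2) unfolding decreases_to_def by blast
  define U where "U n = (\<lambda>y. real_of_ereal (G n y))" for n
  define w where "w = (\<lambda>y. real_of_ereal (f y))"
  have GU: "G n = er (U n)" for n
    by (rule D_cases[OF G(1)[of n]]) (simp add: U_def)
  have U: "U n \<in> V" for n using G(1) unfolding GU in_V_iff .
  have fw: "f = er w"
  proof
    show "f y = ereal (w y)" for y using k[of y] by (cases "f y") (auto simp: w_def)
  qed
  have w_abs: "\<bar>w y\<bar> \<le> k" for y using k[of y] by (simp add: fw)
  have U_lim: "(\<lambda>n. U n y) \<longlonglongrightarrow> w y" for y using G_lim[of y] by (simp add: GU fw)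
  have U_dec: "U n y \<le> U m y" if "m \<le> n" for m n y using G_dec[OF that, of y] by (simp add: GU)
  have wU: "w y \<le> U n y" for n y using fG[of y n] by (simp add: GU fw)
  have U_low: "- k \<le> U n y" for n y using w_abs[of y] wU[of y n] by linarith
  have e_low: "- k \<le> restr \<E> (U n)" for n
    using restr_mono[OF \<E>_nonlinear const_in_V U U_low] by (simp add: restr_const[OF \<E>_nonlinear])
  have e_dec: "decseq (\<lambda>n. restr \<E> (U n))"
    unfolding decseq_def by (intro allI impI restr_mono[OF \<E>_nonlinear U U] U_dec)
  obtain l where l: "(\<lambda>n. restr \<E> (U n)) \<longlonglongrightarrow> l"
    using decseq_convergent[OF e_dec, of "- k"] e_low by blast
  have "decseq U" by (intro decseq_SucI le_funI U_dec) simp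
  \<comment> \<open>The same \<open>E\<close> serves all \<open>n\<close>, so the bound can be
    carried to the limit function under one fixed measure.\<close>
  obtain E where E: "E \<in> admissible" "\<And>n. ereal l \<le> E (er (U n)) - conjugate D \<E> E"
    by (rule exists_admissible[OF U \<open>decseq U\<close> U_low l]) (rule that)
  let ?P = "repr_measure D E"
  interpret prob_space ?P by (rule prob_space_repr_measure[OF E(1)])
  obtain c where c: "conjugate D \<E> E = ereal c" using admissible_conjugate[OF E(1)] by metis
  obtain k0 where k0: "\<And>y. \<bar>U 0 y\<bar> \<le> k0" using bounded_V[OF U] by blast
  have U_abs: "\<bar>U n y\<bar> \<le> k + k0" for n y
    using U_low[of n y] U_dec[of 0 n y] k0[of y] w_abs[of y] by simp
  have measU [measurable]: "U n \<in> borel_measurable ?P" for n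
    using borel_measurable_repr_measure[OF E(1) measurable_D[OF G(1)]] unfolding U_def by simp
  have measw [measurable]: "w \<in> borel_measurable ?P"
    by (rule borel_measurable_LIMSEQ_real[OF U_lim measU])
  have intU: "integrable ?P (U n)" for n
    by (rule integrable_const_bound[of _ "k + k0"]) (auto simp: U_abs)
  have intw: "integrable ?P w"
    by (rule integrable_const_bound[of _ k]) (auto simp: w_abs)
  \<comment> \<open>All \<open>U n\<close> lie between \<open>- k\<close> and the bound
    \<open>k0\<close> of \<open>U 0\<close>, so a constant dominates.\<close>
  have "(\<lambda>n. integral\<^sup>L ?P (U n)) \<longlonglongrightarrow> integral\<^sup>L ?P w"
    by (rule integral_dominated_convergence[where w = "\<lambda>_. k + k0"]) (auto simp: U_abs U_lim)
  moreover have "l + c \<le> integral\<^sup>L ?P (U n)" for n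
  proof -
    have "E (er (U n)) = ereal (integral\<^sup>L ?P (U n))"
      using integral_repr_measure[OF E(1) G(1)[of n]] ereal_integral_ereal[OF intU[of n]] by (simp add: GU)
    then show ?thesis using E(2)[of n] by (simp add: c)
  qed
  ultimately have "l + c \<le> integral\<^sup>L ?P w" by (intro LIMSEQ_le_const) auto
  then have "ereal l \<le> ereal_integral ?P f - conjugate D \<E> E"
    by (simp add: c fw ereal_integral_ereal[OF intw])
  also have "\<dots> \<le> extension D \<E> f" by (rule extension_upper[OF E(1)])
  finally have "ereal l \<le> extension D \<E> f" .
  moreover have "(\<lambda>n. \<E> (G n)) \<longlonglongrightarrow> ereal l"
    using l by (simp add: GU \<E>_er[OF U])
  moreover have "extension D \<E> f \<le> \<E> (G n)" for n
    using extension_mono[of f "G n"] fG by (simp add: extension_D[OF G(1)])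
  ultimately show ?thesis
    by (metis LIMSEQ_le_const antisym)
qed

text \<open>Each \<open>F i\<close> is a decreasing limit of \<open>A i n\<close> in
  \<open>D\<close>. The diagonal minima of \<open>A i n\<close> over \<open>i \<le> n\<close> lie in
  \<open>D\<close>, dominate \<open>F n\<close> and decrease to \<open>f\<close>, so isotony
  squeezes the values at \<open>F n\<close>.\<close>

lemma downward_continuous_extension:
  "downward_continuous_on (D_delta_b D) (M_all D) (extension D \<E>)"
  unfolding downward_continuous_on_def
proof (intro conjI allI impI D_delta_b_subset)
  let ?X = "extension D \<E>"
  fix F f assume F: "\<forall>n. F n \<in> D_delta_b D" and f: "f \<in> D_delta_b D" and Ff: "decreases_to F f"
  have "\<forall>i. \<exists>A. (\<forall>n. A n \<in> D) \<and> decreases_to A (F i)"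
    using F unfolding D_delta_b_def by simp
  from choice[OF this] obtain A where A: "\<And>i n. A i n \<in> D" "\<And>i. decreases_to (A i) (F i)"
    by blast
  note A_dec = decreases_toD[OF A(2)] and FA = decreases_to_lower[OF A(2)]
  note F_dec = decreases_toD[OF Ff] and fF = decreases_to_lower[OF Ff]
  have A_lim: "(\<lambda>n. A i n y) \<longlonglongrightarrow> F i y" for i y using A(2) unfolding decreases_to_def by blast
  have F_lim: "(\<lambda>n. F n y) \<longlonglongrightarrow> f y" for y using Ff unfolding decreases_to_def by blast
  define G where "G n = (\<lambda>y. Min ((\<lambda>i. A i n y) ` {..n}))" for n
  have "(\<lambda>y. Min ((\<lambda>i. A i n y) ` {..m})) \<in> D" for m n
  proof (induction m)
    case (Suc m)
    have "(\<lambda>y. Min ((\<lambda>i. A i n y) ` {..Suc m})) = (\<lambda>y. min (A (Suc m) n y) (Min ((\<lambda>i. A i n y) ` {..m})))"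
      by (simp add: atMost_Suc)
    with D_min[OF A(1) Suc] show ?case by simp
  qed (simp add: A(1))
  then have GD: "G n \<in> D" for n unfolding G_def .
  have GA: "G n y \<le> A i n y" if "i \<le> n" for i n y
    unfolding G_def using that by (intro Min_le) auto
  have FG: "F n y \<le> G n y" for n y
  proof -
    have "F n y \<le> A i n y" if "i \<le> n" for i
      by (rule order_trans[OF F_dec[OF that] FA])
    then show ?thesis unfolding G_def by (intro Min.boundedI) auto
  qed
  have G_dec: "G (Suc n) y \<le> G n y" for n y
  proof -
    have "G (Suc n) y \<le> A i n y" if "i \<le> n" for i
      using that by (intro order_trans[OF GA A_dec]) auto
    then show ?thesis unfolding G_def[of n] by (intro Min.boundedI) auto
  qed
  have "(\<lambda>n. G n y) \<longlonglongrightarrow> f y" for y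
  proof -
    have lim: "(\<lambda>n. G n y) \<longlonglongrightarrow> (INF n. G n y)"
      by (rule LIMSEQ_INF) (simp add: decseq_Suc_iff G_dec)
    \<comment> \<open>For fixed \<open>i\<close>, \<open>G n\<close> is below \<open>A i n\<close>
      once \<open>n \<ge> i\<close>; letting \<open>n\<close> and then \<open>i\<close> grow
      identifies the limit as \<open>f\<close>.\<close>
    have "(INF n. G n y) \<le> F i y" for i
    proof (rule LIMSEQ_le[OF lim A_lim])
      show "\<exists>N. \<forall>n\<ge>N. G n y \<le> A i n y" using GA by blast
    qed
    then have "(INF n. G n y) \<le> f y" by (intro LIMSEQ_le_const[OF F_lim]) blast
    moreover have "f y \<le> (INF n. G n y)"
      by (rule INF_greatest) (rule order_trans[OF fF FG])
    ultimately show ?thesis using lim by simp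
  qed
  then have "decreases_to G f"
    unfolding decreases_to_def using G_dec by (auto intro!: decseq_SucI le_funI)
  then have "(\<lambda>n. \<E> (G n)) \<longlonglongrightarrow> ?X f"
    by (intro decreasing_limit_of_D GD) (use f in \<open>simp_all add: D_delta_b_def\<close>)
  then have lim: "(\<lambda>n. ?X (G n)) \<longlonglongrightarrow> ?X f" by (simp add: extension_D GD)
  show "(\<lambda>n. ?X (F n)) \<longlonglongrightarrow> ?X f"
  proof (rule tendsto_sandwich[OF _ _ tendsto_const lim])
    show "\<forall>\<^sub>F n in sequentially. ?X f \<le> ?X (F n)"
      by (intro always_eventually allI extension_mono fF)
    show "\<forall>\<^sub>F n in sequentially. ?X (F n) \<le> ?X (G n)"
      by (intro always_eventually allI extension_mono FG)
  qed
qed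

text \<open>The suprema over \<open>E\<close> and over \<open>n\<close> are interchanged: for each
  \<open>E\<close> the integrals converge monotonically, as the lower bound of \<open>F 0\<close>
  keeps its negative part integrable.\<close>

lemma upward_continuous_extension:
  "upward_continuous_on (M_below D) (M_all D) (extension D \<E>)"
  unfolding upward_continuous_on_def
proof (intro conjI allI impI)
  let ?X = "extension D \<E>"
  show "M_below D \<subseteq> M_all D" unfolding M_all_def by blast
  fix F f assume F: "\<forall>n. F n \<in> M_below D" and f: "f \<in> M_below D" and Ff: "increases_to F f"
  have inc: "incseq F" and lim: "\<And>y. (\<lambda>n. F n y) \<longlonglongrightarrow> f y"
    using Ff unfolding increases_to_def by auto
  have mono: "F m y \<le> F n y" if "m \<le> n" for m n y
    using inc that by (simp add: incseq_def le_fun_def)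
  have le: "F n y \<le> f y" for n y
    by (rule incseq_le[OF _ lim]) (simp add: incseq_def mono)
  have X_inc: "incseq (\<lambda>n. ?X (F n))"
    unfolding incseq_def by (intro allI impI extension_mono mono)
  have "?X f \<le> (SUP n. ?X (F n))"
    unfolding extension_eq[of f]
  proof (rule SUP_least)
    fix E assume E: "E \<in> admissible"
    let ?P = "repr_measure D E"
    interpret prob_space ?P by (rule prob_space_repr_measure[OF E])
    obtain c where c: "conjugate D \<E> E = ereal c" using admissible_conjugate[OF E] by metis
    have meas: "F n \<in> borel_measurable ?P" for n
      using F borel_measurable_repr_measure[OF E] unfolding M_below_def by blast
    have fin: "(\<integral>\<^sup>+ y. e2ennreal (- F 0 y) \<partial>?P) < \<infinity>"
    proof -
      have "- \<infinity> < (INF y. F 0 y)" using F unfolding M_below_def by blast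
      then obtain b where b: "ereal b < (INF y. F 0 y)" using ereal_dense2 by blast
      have "- F 0 y \<le> ereal (- b)" for y
      proof -
        have "ereal b < F 0 y" using b by (meson INF_lower UNIV_I less_le_trans)
        then show ?thesis by (cases "F 0 y") auto
      qed
      then have "(\<integral>\<^sup>+ y. e2ennreal (- F 0 y) \<partial>?P) \<le> (\<integral>\<^sup>+ y. e2ennreal (ereal (- b)) \<partial>?P)"
        by (intro nn_integral_mono e2ennreal_mono)
      also have "\<dots> < \<infinity>" by (simp add: emeasure_space_1)
      finally show ?thesis .
    qed
    have "(\<lambda>n. ereal_integral ?P (F n)) \<longlonglongrightarrow> ereal_integral ?P f"
      by (rule ereal_integral_monotone_convergence[OF meas inc lim fin])
    then have "(\<lambda>n. ereal_integral ?P (F n) - ereal c) \<longlonglongrightarrow> ereal_integral ?P f - ereal c"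
      by (intro tendsto_diff_ereal_general) auto
    moreover have "ereal_integral ?P (F n) - ereal c \<le> (SUP n. ?X (F n))" for n
      using extension_upper[OF E, of "F n"] unfolding c by (intro SUP_upper2[of n]) auto
    ultimately show "ereal_integral ?P f - conjugate D \<E> E \<le> (SUP n. ?X (F n))"
      unfolding c by (intro LIMSEQ_le_const2) auto
  qed
  moreover have "(SUP n. ?X (F n)) \<le> ?X f"
    by (intro SUP_least extension_mono le)
  ultimately show "(\<lambda>n. ?X (F n)) \<longlonglongrightarrow> ?X f"
    using LIMSEQ_SUP[OF X_inc] by (metis antisym)
qed

section \<open>The sublinear case\<close>

lemma conjugate_upper_expectation:
  assumes up: "upper_expectation D \<E>" and E: "E \<in> admissible"
  shows "conjugate D \<E> E = 0"
proof -
  note lin = admissible_linear[OF E]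
  obtain c where c: "0 \<le> c" "conjugate D \<E> E = ereal c" "\<And>u. u \<in> V \<Longrightarrow> restr E u - restr \<E> u \<le> c"
    using admissible_conjugate[OF E] by metis
  have "restr E u - restr \<E> u \<le> 0" if u: "u \<in> V" for u
  proof (rule ccontr)
    assume "\<not> restr E u - restr \<E> u \<le> 0"
    define d where "d = restr E u - restr \<E> u"
    \<comment> \<open>A positive difference \<open>d\<close> at \<open>u\<close> grows to
      \<open>k * d = c + 1\<close> at \<open>k u\<close>, exceeding the bound
      \<open>c\<close>.\<close>
    define k where "k = (c + 1) / d"
    have d: "0 < d" using \<open>\<not> _\<close> by (simp add: d_def)
    have k: "0 \<le> k" using c(1) d by (simp add: k_def)
    have w: "k *\<^sub>R u \<in> V" by (rule subspace_scale[OF subspace_V u])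
    have eq: "(\<lambda>y. ereal k * er u y) = er (k *\<^sub>R u)" by simp
    have "positively_homogeneous D \<E>"
      using up unfolding upper_expectation_def sublinear_expectation_def by blast
    then have "\<E> (\<lambda>y. ereal k * er u y) = ereal k * \<E> (er u)"
      by (rule positively_homogeneousD) (use u w k in \<open>simp_all add: in_V_iff\<close>)
    then have "restr \<E> (k *\<^sub>R u) = k * restr \<E> u"
      unfolding eq \<E>_er[OF u] \<E>_er[OF w] by simp
    moreover have "restr E (k *\<^sub>R u) = k * restr E u"
      using linear_functional_on_restr[OF lin] u unfolding linear_functional_on_def by blast
    ultimately have "k * d \<le> c" using c(3)[OF w] by (simp add: d_def right_diff_distrib)
    then show False using d by (simp add: k_def)
  qed
  then have "conjugate D \<E> E \<le> ereal 0" unfolding conjugate_le_iff[OF lin] by blast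
  with conjugate_nonneg[OF lin] show ?thesis by (simp add: zero_ereal_def antisym)
qed

text \<open>With all conjugates zero, the extension is a supremum of integrals, each additive below
  \<open>\<infinity>\<close> and positively homogeneous.\<close>

lemma sublinear_extension:
  assumes up: "upper_expectation D \<E>"
  shows "sublinear_expectation (M_all D) (extension D \<E>)"
proof -
  let ?X = "extension D \<E>"
  let ?I = "\<lambda>E. ereal_integral (repr_measure D E)"
  have X: "?X f = (SUP E\<in>admissible. ?I E f)" for f
    unfolding extension_eq by (intro SUP_cong refl) (simp add: conjugate_upper_expectation[OF up])
  have upper: "?I E f \<le> ?X f" if "E \<in> admissible" for E f
    unfolding X using that by (rule SUP_upper)
  \<comment> \<open>The zero sequence yields an admissible expectation. Nonemptiness matters for
    pulling the factor \<open>\<mu> = 0\<close> out of the supremum, since an empty supremum is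
    \<open>-\<infinity>\<close>.\<close>
  obtain E0 where E0: "E0 \<in> admissible"
    by (rule exists_admissible[of "\<lambda>n y. 0" 0 0])
      (auto simp: const_in_V decseq_def restr_const[OF \<E>_nonlinear])
  have "subadditive (M_all D) ?X"
    unfolding subadditive_def
  proof (intro ballI impI)
    fix f g assume fg: "f \<in> M_all D" "g \<in> M_all D" and m: "meaningful_fun f g"
    show "?X (\<lambda>y. f y + g y) \<le> ?X f + ?X g"
    proof (cases "?X f = \<infinity> \<or> ?X g = \<infinity>")
      case True
      then show ?thesis by auto
    next
      case False
      show ?thesis
        unfolding X[of "\<lambda>y. f y + g y"]
      proof (rule SUP_least)
        fix E assume E: "E \<in> admissible"
        have "?I E (\<lambda>y. f y + g y) = ?I E f + ?I E g"
          using integral_less_top[OF E] False fg m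
          by (intro ereal_integral_add borel_measurable_repr_measure[OF E] M_all_measurable) auto
        also have "\<dots> \<le> ?X f + ?X g" by (intro add_mono upper E)
        finally show "?I E (\<lambda>y. f y + g y) \<le> ?X f + ?X g" .
      qed
    qed
  qed
  moreover have "positively_homogeneous (M_all D) ?X"
    unfolding positively_homogeneous_def
  proof (intro ballI allI impI)
    fix f and \<mu> :: real assume f: "f \<in> M_all D" and \<mu>: "0 \<le> \<mu>"
    have "?X (\<lambda>y. ereal \<mu> * f y) = (SUP E\<in>admissible. ereal \<mu> * ?I E f)"
      unfolding X using f \<mu>
      by (intro SUP_cong refl ereal_integral_cmult borel_measurable_repr_measure M_all_measurable)
    also have "\<dots> = ereal \<mu> * ?X f"
      unfolding X using E0 \<mu> by (intro Sup_ereal_mult_left'[symmetric]) auto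
    finally show "?X (\<lambda>y. ereal \<mu> * f y) = ereal \<mu> * ?X f" .
  qed
  ultimately show ?thesis
    unfolding sublinear_expectation_def using nonlinear_expectation_extension by blast
qed

end

theorem theorem3:
  fixes D :: "('y \<Rightarrow> ereal) set"
    and \<E> :: "('y \<Rightarrow> ereal) \<Rightarrow> ereal"
  assumes "D \<subseteq> bounded_real_functions"
    and "linear_space_of_real_functions D"
    and "\<forall>c::real. (\<lambda>y. ereal c) \<in> D"
    and "\<forall>f\<in>D. \<forall>g\<in>D. (\<lambda>y. min (f y) (g y)) \<in> D"
    and "convex_expectation D \<E>"
    and "downward_continuous D \<E>"
  shows "convex_expectation (M_all D) (extension D \<E>)
    \<and> extends_functional (M_all D) (extension D \<E>) D \<E>
    \<and> downward_continuous_on (D_delta_b D) (M_all D) (extension D \<E>)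
    \<and> upward_continuous_on (M_below D) (M_all D) (extension D \<E>)
    \<and> (upper_expectation D \<E> \<longrightarrow> sublinear_expectation (M_all D) (extension D \<E>))"
proof -
  interpret continuous_convex_expectation D \<E>
    using assms by unfold_locales auto
  show ?thesis
    unfolding convex_expectation_def extends_functional_def
    by (intro conjI ballI impI nonlinear_expectation_extension convex_extension D_subset_M_all
        extension_D downward_continuous_extension upward_continuous_extension sublinear_extension)
qed

end
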